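(* Let $(\mathcal{C},\cdot,n)$ be a Cayley algebra over a field $\mathbb{F}$ of characteristic not $3$, and let $\tau$ be an order $3$ automorphism of $(\mathcal{C},\cdot,n)$. Then one of the following conditions holds: (1) There is an element $w\in\mathcal{C}\setminus\mathbb{F}1$ with $w^2+w+1=0$ such that $\tau(x)=w\cdot x\cdot w^2$ for any $x\in\mathcal{C}$. In this case, the Petersson algebra $\mathcal{C}_\tau$ is para-Cayley with para-unit $w$, and the subalgebra $\mathrm{Fix}(\tau)=\{x\in\mathcal{C}:\tau(x)=x\}$ is $\mathbb{F}1+\mathbb{F}w$ (a quadratic étale subalgebra). Any two such automorphisms are conjugate in $\mathrm{Aut}(\mathcal{C},\cdot,n)$. (2) The subalgebra $\mathrm{Fix}(\tau)$ is a quaternion subalgebra of $\mathcal{C}$ containing an element $w\in\mathcal{C}\setminus\mathbb{F}1$ such that $w^2+w+1=0$. In this case the Petersson algebra $\mathcal{C}_\tau$ is an Okubo algebra. Any two such automorphisms (i.e. order $3$ automorphisms of $(\mathcal{C},\cdot,n)$ satisfying (2)) are conjugate in $\mathrm{Aut}(\mathcal{C},\cdot,n)$ if and only if the corresponding quaternion subalgebras (their subalgebras of fixed elements) are isomorphic. In particular, if $\mathbb{F}$ contains the cubic roots of $1$, then $\mathcal{C}$ is the split Cayley algebra, $\mathcal{C}_\tau$ is the split Okubo algebra, and any two such automorphisms are conjugate.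
   Context: A composition algebra over a field $\mathbb{F}$ is a triple $(\mathcal{C},*,n)$ where $(\mathcal{C},* )$ is a not necessarily associative $\mathbb{F}$-algebra and $n$ is a nonsingular quadratic form with $n(x*y)=n(x)n(y)$; the polar form is $n(x,y)=n(x+y)-n(x)-n(y)$. (Nonsingular: the radical of the polar form is $0$, or one-dimensional with $n$ nonzero on its nonzero elements.) A Hurwitz algebra is a unital composition algebra; Hurwitz algebras have dimension $1,2,4,8$, and those of dimension $2$, $4$, $8$ are respectively the quadratic étale algebras, the quaternion algebras and the Cayley algebras. The standard conjugation of a Hurwitz algebra is $\bar x=n(x,1)1-x$. A composition algebra $(\mathcal{S},*,n)$ is symmetric if $n(x*y,z)=n(x,y*z)$ for all $x,y,z$. Given a Hurwitz algebra $(\mathcal{C},\cdot,n)$ and an automorphism $\tau$ with $\tau^3=\mathrm{id}$, the Petersson algebra $\mathcal{C}_\tau=(\mathcal{C},*,n)$ is the symmetric composition algebra with $x*y=\tau(\bar x)\cdot\tau^2(\bar y)$ and the same norm. For $\tau=\mathrm{id}$ it is called the para-Hurwitz algebra attached to $\mathcal{C}$ (para-Cayley if $\dim\mathcal{C}=8$). A para-unit of a symmetric composition algebra $(\mathcal{S},*,n)$ is a nonzero idempotent $e$ with $e*x=x*e=n(e,x)e-x$ for all $x$; a para-Cayley algebra has a unique para-unit. The split Cayley algebra (Zorn matrix algebra) is the Cayley algebra with basis $e_1,e_2,u_1,u_2,u_3,v_1,v_2,v_3$ (a "canonical basis") where $e_1,e_2$ are orthogonal idempotents with $e_1+e_2=1$,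 $e_1u_i=u_i=u_ie_2$, $e_2v_i=v_i=v_ie_1$, $e_2u_i=u_ie_1=e_1v_i=v_ie_2=0$, $u_iu_{i+1}=v_{i+2}=-u_{i+1}u_i$, $v_iv_{i+1}=u_{i+2}=-v_{i+1}v_i$ (indices modulo $3$), $u_i^2=v_i^2=0$, $u_iv_i=-e_1$, $v_iu_i=-e_2$, $u_iv_j=v_iu_j=0$ for $i\ne j$. Its order $3$ automorphism $\tau_{st}$ fixes $e_1,e_2$ and maps $u_i\mapsto u_{i+1}$, $v_i\mapsto v_{i+1}$ (indices modulo $3$). The split Okubo algebra is the Petersson algebra $\mathcal{C}_{\tau_{st}}$ of the split Cayley algebra, and an Okubo algebra is an algebra that becomes isomorphic to the split Okubo algebra after an extension of scalars. *)

theory Defs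
  imports
    "HOL-Algebra.Algebraic_Closure_Type"
    "HOL-Analysis.Cartesian_Space"
    "HOL-Library.Numeral_Type"
begin

section \<open>Composition algebras\<close>

text \<open>
  Algebras live on a subspace \<open>A\<close> of an ambient vector space, so that the same predicates apply
  to a whole algebra (\<open>A = UNIV\<close>) and to its subalgebras. Products are functions on the ambient
  type of which only the values on \<open>A\<close> matter.
\<close>

locale nonassoc_algebra = vector_space smul
  for smul :: "'f::field \<Rightarrow> 'a::ab_group_add \<Rightarrow> 'a" +
  fixes A :: "'a set" and mul :: "'a \<Rightarrow> 'a \<Rightarrow> 'a"
  assumes subspace_carrier: "subspace A"
    and mult_closed: "x \<in> A \<Longrightarrow> y \<in> A \<Longrightarrow> mul x y \<in> A"
    and mult_add_left: "x \<in> A \<Longrightarrow> y \<in> A \<Longrightarrow> z \<in> A \<Longrightarrow> mul (x + y) z = mul x z + mul y z"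
    and mult_add_right: "x \<in> A \<Longrightarrow> y \<in> A \<Longrightarrow> z \<in> A \<Longrightarrow> mul x (y + z) = mul x y + mul x z"
    and mult_scale_left: "x \<in> A \<Longrightarrow> y \<in> A \<Longrightarrow> mul (smul a x) y = smul a (mul x y)"
    and mult_scale_right: "x \<in> A \<Longrightarrow> y \<in> A \<Longrightarrow> mul x (smul a y) = smul a (mul x y)"

definition polar :: "('a::ab_group_add \<Rightarrow> 'f::field) \<Rightarrow> 'a \<Rightarrow> 'a \<Rightarrow> 'f" where
  "polar n x y = n (x + y) - n x - n y"

definition polar_radical :: "'a::ab_group_add set \<Rightarrow> ('a \<Rightarrow> 'f::field) \<Rightarrow> 'a set" where
  "polar_radical A n = {x \<in> A. \<forall>y\<in>A. polar n x y = 0}"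

locale composition_algebra = nonassoc_algebra smul A mul
  for smul :: "'f::field \<Rightarrow> 'a::ab_group_add \<Rightarrow> 'a" and A mul +
  fixes n :: "'a \<Rightarrow> 'f"
  assumes norm_scale: "x \<in> A \<Longrightarrow> n (smul a x) = a\<^sup>2 * n x"
    and polar_add_left: "x \<in> A \<Longrightarrow> y \<in> A \<Longrightarrow> z \<in> A \<Longrightarrow> polar n (x + y) z = polar n x z + polar n y z"
    and polar_scale_left: "x \<in> A \<Longrightarrow> y \<in> A \<Longrightarrow> polar n (smul a x) y = a * polar n x y"
    and nonsingular: "polar_radical A n = {0} \<or>
      dim (polar_radical A n) = 1 \<and> (\<forall>x \<in> polar_radical A n. x \<noteq> 0 \<longrightarrow> n x \<noteq> 0)"
    and norm_mult: "x \<in> A \<Longrightarrow> y \<in> A \<Longrightarrow> n (mul x y) = n x * n y"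

locale symmetric_composition_algebra = composition_algebra +
  assumes polar_assoc: "x \<in> A \<Longrightarrow> y \<in> A \<Longrightarrow> z \<in> A \<Longrightarrow>
    polar n (mul x y) z = polar n x (mul y z)"

locale hurwitz_algebra = composition_algebra smul A mul n
  for smul :: "'f::field \<Rightarrow> 'a::ab_group_add \<Rightarrow> 'a" and A mul n +
  fixes e :: 'a
  assumes one_closed: "e \<in> A"
    and one_left: "x \<in> A \<Longrightarrow> mul e x = x"
    and one_right: "x \<in> A \<Longrightarrow> mul x e = x"

locale quadratic_etale_algebra = hurwitz_algebra +
  assumes dim_carrier: "dim A = 2"

locale quaternion_algebra = hurwitz_algebra +
  assumes dim_carrier: "dim A = 4"

locale cayley_algebra = hurwitz_algebra +
  assumes dim_carrier: "dim A = 8"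

definition conjugation ::
    "('f::field \<Rightarrow> 'a::ab_group_add \<Rightarrow> 'a) \<Rightarrow> ('a \<Rightarrow> 'f) \<Rightarrow> 'a \<Rightarrow> 'a \<Rightarrow> 'a" where
  "conjugation smul n e x = smul (polar n x e) e - x"

definition petersson ::
    "('f::field \<Rightarrow> 'a::ab_group_add \<Rightarrow> 'a) \<Rightarrow> ('a \<Rightarrow> 'a \<Rightarrow> 'a) \<Rightarrow> ('a \<Rightarrow> 'f) \<Rightarrow> 'a
      \<Rightarrow> ('a \<Rightarrow> 'a) \<Rightarrow> 'a \<Rightarrow> 'a \<Rightarrow> 'a" where
  "petersson smul mul n e \<tau> x y =
     mul (\<tau> (conjugation smul n e x)) (\<tau> (\<tau> (conjugation smul n e y)))"

definition para_cayley_algebra ::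
    "('f::field \<Rightarrow> 'a::ab_group_add \<Rightarrow> 'a) \<Rightarrow> 'a set \<Rightarrow> ('a \<Rightarrow> 'a \<Rightarrow> 'a) \<Rightarrow> ('a \<Rightarrow> 'f) \<Rightarrow> bool" where
  "para_cayley_algebra smul A star n \<longleftrightarrow>
     (\<exists>mul e. cayley_algebra smul A mul n e \<and>
        (\<forall>x\<in>A. \<forall>y\<in>A. star x y = petersson smul mul n e id x y))"

definition para_unit ::
    "('f::field \<Rightarrow> 'a::ab_group_add \<Rightarrow> 'a) \<Rightarrow> 'a set \<Rightarrow> ('a \<Rightarrow> 'a \<Rightarrow> 'a) \<Rightarrow> ('a \<Rightarrow> 'f) \<Rightarrow> 'a \<Rightarrow> bool" where
  "para_unit smul A star n e \<longleftrightarrow>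
     symmetric_composition_algebra smul A star n \<and>
     e \<in> A \<and> e \<noteq> 0 \<and> star e e = e \<and>
     (\<forall>x\<in>A. star e x = smul (polar n e x) e - x \<and> star x e = smul (polar n e x) e - x)"


section \<open>Isomorphisms and automorphisms\<close>

definition algebra_isomorphism ::
    "('f::field \<Rightarrow> 'a::ab_group_add \<Rightarrow> 'a) \<Rightarrow> 'a set \<Rightarrow> ('a \<Rightarrow> 'a \<Rightarrow> 'a)
      \<Rightarrow> ('f \<Rightarrow> 'b::ab_group_add \<Rightarrow> 'b) \<Rightarrow> 'b set \<Rightarrow> ('b \<Rightarrow> 'b \<Rightarrow> 'b) \<Rightarrow> ('a \<Rightarrow> 'b) \<Rightarrow> bool" where
  "algebra_isomorphism smul A mul smul' B mul' f \<longleftrightarrow>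
     bij_betw f A B \<and>
     (\<forall>x\<in>A. \<forall>y\<in>A. f (x + y) = f x + f y) \<and>
     (\<forall>a. \<forall>x\<in>A. f (smul a x) = smul' a (f x)) \<and>
     (\<forall>x\<in>A. \<forall>y\<in>A. f (mul x y) = mul' (f x) (f y))"

definition composition_isomorphism ::
    "('f::field \<Rightarrow> 'a::ab_group_add \<Rightarrow> 'a) \<Rightarrow> 'a set \<Rightarrow> ('a \<Rightarrow> 'a \<Rightarrow> 'a) \<Rightarrow> ('a \<Rightarrow> 'f)
      \<Rightarrow> ('f \<Rightarrow> 'b::ab_group_add \<Rightarrow> 'b) \<Rightarrow> 'b set \<Rightarrow> ('b \<Rightarrow> 'b \<Rightarrow> 'b) \<Rightarrow> ('b \<Rightarrow> 'f) \<Rightarrow> ('a \<Rightarrow> 'b) \<Rightarrow> bool"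
where
  "composition_isomorphism smul A mul n smul' B mul' n' f \<longleftrightarrow>
     algebra_isomorphism smul A mul smul' B mul' f \<and> (\<forall>x\<in>A. n' (f x) = n x)"

definition composition_automorphism ::
    "('f::field \<Rightarrow> 'a::ab_group_add \<Rightarrow> 'a) \<Rightarrow> ('a \<Rightarrow> 'a \<Rightarrow> 'a) \<Rightarrow> ('a \<Rightarrow> 'f) \<Rightarrow> ('a \<Rightarrow> 'a) \<Rightarrow> bool" where
  "composition_automorphism smul mul n f \<longleftrightarrow>
     composition_isomorphism smul UNIV mul n smul UNIV mul n f"

definition order_three_automorphism ::
    "('f::field \<Rightarrow> 'a::ab_group_add \<Rightarrow> 'a) \<Rightarrow> ('a \<Rightarrow> 'a \<Rightarrow> 'a) \<Rightarrow> ('a \<Rightarrow> 'f) \<Rightarrow> ('a \<Rightarrow> 'a) \<Rightarrow> bool" where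
  "order_three_automorphism smul mul n \<tau> \<longleftrightarrow>
     composition_automorphism smul mul n \<tau> \<and> \<tau> \<circ> \<tau> \<circ> \<tau> = id \<and> \<tau> \<noteq> id"

definition conjugate_automorphisms ::
    "('f::field \<Rightarrow> 'a::ab_group_add \<Rightarrow> 'a) \<Rightarrow> ('a \<Rightarrow> 'a \<Rightarrow> 'a) \<Rightarrow> ('a \<Rightarrow> 'f)
      \<Rightarrow> ('a \<Rightarrow> 'a) \<Rightarrow> ('a \<Rightarrow> 'a) \<Rightarrow> bool" where
  "conjugate_automorphisms smul mul n \<tau>\<^sub>1 \<tau>\<^sub>2 \<longleftrightarrow>
     (\<exists>\<phi>. composition_automorphism smul mul n \<phi> \<and> \<tau>\<^sub>2 \<circ> \<phi> = \<phi> \<circ> \<tau>\<^sub>1)"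

definition Fix :: "('a \<Rightarrow> 'a) \<Rightarrow> 'a set" where
  "Fix \<tau> = {x. \<tau> x = x}"


section \<open>The split Cayley algebra and the Okubo algebras\<close>

text \<open>
  Coordinates with respect to a canonical basis. The indices of the \<open>u\<^sub>i\<close> and \<open>v\<^sub>i\<close> are taken in the
  three-element type \<open>3\<close>, whose arithmetic is modulo 3.
\<close>

datatype zorn_index = E1 | E2 | U 3 | V 3

instance zorn_index :: finite
proof
  have "(UNIV :: zorn_index set) = {E1, E2} \<union> range U \<union> range V"
    using zorn_index.exhaust by blast
  moreover have "finite ({E1, E2} \<union> range U \<union> range V)" by simp
  ultimately show "finite (UNIV :: zorn_index set)" by simp
qed

fun zorn_table :: "zorn_index \<Rightarrow> zorn_index \<Rightarrow> 'k::field ^ zorn_index" where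
  "zorn_table E1 E1 = axis E1 1"
| "zorn_table E2 E2 = axis E2 1"
| "zorn_table E1 E2 = 0"
| "zorn_table E2 E1 = 0"
| "zorn_table E1 (U i) = axis (U i) 1"
| "zorn_table (U i) E2 = axis (U i) 1"
| "zorn_table E2 (V i) = axis (V i) 1"
| "zorn_table (V i) E1 = axis (V i) 1"
| "zorn_table E2 (U i) = 0"
| "zorn_table (U i) E1 = 0"
| "zorn_table E1 (V i) = 0"
| "zorn_table (V i) E2 = 0"
| "zorn_table (U i) (U j) =
     (if j = i + 1 then axis (V (i + 2)) 1 else if i = j + 1 then - axis (V (j + 2)) 1 else 0)"
| "zorn_table (V i) (V j) =
     (if j = i + 1 then axis (U (i + 2)) 1 else if i = j + 1 then - axis (U (j + 2)) 1 else 0)"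
| "zorn_table (U i) (V j) = (if i = j then - axis E1 1 else 0)"
| "zorn_table (V i) (U j) = (if i = j then - axis E2 1 else 0)"

definition zorn_mult :: "'k::field ^ zorn_index \<Rightarrow> 'k ^ zorn_index \<Rightarrow> 'k ^ zorn_index" where
  "zorn_mult x y = (\<Sum>p\<in>UNIV. \<Sum>q\<in>UNIV. (x $ p * y $ q) *s zorn_table p q)"

text \<open>
  The norm of a Hurwitz algebra is determined by its product, through \<open>x \<cdot> conj x = n(x) 1\<close>;
  for the table above it is the following form.
\<close>

definition zorn_norm :: "'k::field ^ zorn_index \<Rightarrow> 'k" where
  "zorn_norm x = x $ E1 * x $ E2 + (\<Sum>i\<in>UNIV. x $ U i * x $ V i)"

definition zorn_unit :: "'k::field ^ zorn_index" where
  "zorn_unit = axis E1 1 + axis E2 1"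

fun zorn_shift :: "zorn_index \<Rightarrow> zorn_index" where
  "zorn_shift E1 = E1"
| "zorn_shift E2 = E2"
| "zorn_shift (U i) = U (i + 1)"
| "zorn_shift (V i) = V (i + 1)"

definition tau_st :: "'k::field ^ zorn_index \<Rightarrow> 'k ^ zorn_index" where
  "tau_st x = (\<Sum>p\<in>UNIV. x $ p *s axis (zorn_shift p) 1)"

definition split_okubo_mult :: "'k::field ^ zorn_index \<Rightarrow> 'k ^ zorn_index \<Rightarrow> 'k ^ zorn_index" where
  "split_okubo_mult = petersson (*s) zorn_mult zorn_norm zorn_unit tau_st"

definition is_split_cayley ::
    "('f::field \<Rightarrow> 'a::ab_group_add \<Rightarrow> 'a) \<Rightarrow> 'a set \<Rightarrow> ('a \<Rightarrow> 'a \<Rightarrow> 'a) \<Rightarrow> ('a \<Rightarrow> 'f) \<Rightarrow> bool" where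
  "is_split_cayley smul A mul n \<longleftrightarrow>
     (\<exists>f. composition_isomorphism smul A mul n (*s) UNIV zorn_mult zorn_norm f)"

definition is_split_okubo ::
    "('f::field \<Rightarrow> 'a::ab_group_add \<Rightarrow> 'a) \<Rightarrow> 'a set \<Rightarrow> ('a \<Rightarrow> 'a \<Rightarrow> 'a) \<Rightarrow> ('a \<Rightarrow> 'f) \<Rightarrow> bool" where
  "is_split_okubo smul A star n \<longleftrightarrow>
     (\<exists>f. composition_isomorphism smul A star n (*s) UNIV split_okubo_mult zorn_norm f)"

definition (in vector_space) basis_of :: "'b set \<Rightarrow> 'b set \<Rightarrow> bool" where
  "basis_of B A \<longleftrightarrow> independent B \<and> span B = A"

text \<open>
  \<open>\<iota>\<close> exhibits the \<open>'k\<close>-algebra on \<open>A'\<close> as the scalar extension, along the field embedding \<open>\<sigma>\<close>,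
  of the \<open>'f\<close>-algebra on \<open>A\<close>: it is a \<open>\<sigma>\<close>-semilinear multiplicative map carrying a basis of \<open>A\<close>
  bijectively onto a basis of \<open>A'\<close>. Equivalently, the induced homomorphism of \<open>'k\<close>-algebras from
  the tensor product of \<open>'k\<close> and \<open>A\<close> over \<open>'f\<close> to \<open>A'\<close> is an isomorphism.
\<close>

definition scalar_extension ::
    "('f::field \<Rightarrow> 'k::field) \<Rightarrow> ('f \<Rightarrow> 'a::ab_group_add \<Rightarrow> 'a) \<Rightarrow> 'a set \<Rightarrow> ('a \<Rightarrow> 'a \<Rightarrow> 'a)
      \<Rightarrow> ('k \<Rightarrow> 'b::ab_group_add \<Rightarrow> 'b) \<Rightarrow> 'b set \<Rightarrow> ('b \<Rightarrow> 'b \<Rightarrow> 'b) \<Rightarrow> ('a \<Rightarrow> 'b) \<Rightarrow> bool" where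
  "scalar_extension \<sigma> smul A mul smul' A' mul' \<iota> \<longleftrightarrow>
     \<sigma> 1 = 1 \<and> (\<forall>a b. \<sigma> (a + b) = \<sigma> a + \<sigma> b) \<and> (\<forall>a b. \<sigma> (a * b) = \<sigma> a * \<sigma> b) \<and>
     (\<forall>x\<in>A. \<forall>y\<in>A. \<iota> (x + y) = \<iota> x + \<iota> y) \<and>
     (\<forall>a. \<forall>x\<in>A. \<iota> (smul a x) = smul' (\<sigma> a) (\<iota> x)) \<and>
     (\<forall>x\<in>A. \<forall>y\<in>A. \<iota> (mul x y) = mul' (\<iota> x) (\<iota> y)) \<and>
     (\<exists>B. vector_space.basis_of smul B A \<and> inj_on \<iota> B \<and>
          vector_space.basis_of smul' (\<iota> ` B) A')"

text \<open>
  Field extensions cannot be quantified over as types, so the extension in the definition of an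
  Okubo algebra is taken to be the algebraic closure of the ground field. Nothing is lost: a
  finite-dimensional algebra that becomes isomorphic to the split Okubo algebra over some
  extension field does so over the algebraic closure of the ground field.
\<close>

definition okubo_algebra ::
    "('f::field \<Rightarrow> 'a::ab_group_add \<Rightarrow> 'a) \<Rightarrow> 'a set \<Rightarrow> ('a \<Rightarrow> 'a \<Rightarrow> 'a) \<Rightarrow> bool" where
  "okubo_algebra smul A star \<longleftrightarrow>
     (\<exists>\<iota> :: 'a \<Rightarrow> 'f alg_closure ^ zorn_index.
        scalar_extension to_ac smul A star (*s) UNIV split_okubo_mult \<iota>)"


section \<open>The two kinds of automorphisms\<close>

definition primitive_cube_root ::
    "('f::field \<Rightarrow> 'a::ab_group_add \<Rightarrow> 'a) \<Rightarrow> ('a \<Rightarrow> 'a \<Rightarrow> 'a) \<Rightarrow> 'a \<Rightarrow> 'a \<Rightarrow> bool" where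
  "primitive_cube_root smul mul e w \<longleftrightarrow>
     w \<notin> range (\<lambda>a. smul a e) \<and> mul w w + w + e = 0"

text \<open>
  The bracketing of \<open>w \<cdot> x \<cdot> w\<^sup>2\<close> is immaterial, since any two elements of a Hurwitz algebra generate
  an associative subalgebra.
\<close>

definition conjugation_by_cube_root ::
    "('f::field \<Rightarrow> 'a::ab_group_add \<Rightarrow> 'a) \<Rightarrow> ('a \<Rightarrow> 'a \<Rightarrow> 'a) \<Rightarrow> 'a \<Rightarrow> ('a \<Rightarrow> 'a) \<Rightarrow> 'a \<Rightarrow> bool" where
  "conjugation_by_cube_root smul mul e \<tau> w \<longleftrightarrow>
     primitive_cube_root smul mul e w \<and> (\<forall>x. \<tau> x = mul (mul w x) (mul w w))"

definition fixes_quaternion_with_cube_root ::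
    "('f::field \<Rightarrow> 'a::ab_group_add \<Rightarrow> 'a) \<Rightarrow> ('a \<Rightarrow> 'a \<Rightarrow> 'a) \<Rightarrow> ('a \<Rightarrow> 'f) \<Rightarrow> 'a
      \<Rightarrow> ('a \<Rightarrow> 'a) \<Rightarrow> bool" where
  "fixes_quaternion_with_cube_root smul mul n e \<tau> \<longleftrightarrow>
     quaternion_algebra smul (Fix \<tau>) mul n e \<and>
     (\<exists>w \<in> Fix \<tau>. primitive_cube_root smul mul e w)"

end

theory Submission
  imports Defs
begin

text \<open>
  If \<open>x\<close> is an anisotropic vector orthogonal to \<open>Fix \<tau>\<close>, then \<open>x + \<tau> x + \<tau>\<^sup>2 x = 0\<close>, and
  \<open>u = \<tau>(x) x\<^sup>-\<^sup>1\<close> turns out to be a fixed cube root of \<open>1\<close> with \<open>\<tau> x = u x\<close>. So \<open>Fix \<tau>\<close> contains the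
  quadratic algebra \<open>F[u]\<close>. If the two coincide, Cayley-Dickson doubling forces \<open>\<tau>\<close> to act as left
  multiplication by \<open>u\<close> on the whole orthogonal complement of \<open>F[u]\<close>, which makes \<open>\<tau>\<close> the conjugation
  by \<open>bar u\<close>; otherwise \<open>Fix \<tau>\<close> is the double of \<open>F[u]\<close>.

  Both types are thus described by a frame \<open>(w, a, b)\<close>: a cube root \<open>w\<close>, a vector \<open>a\<close> orthogonal to
  \<open>F[w]\<close>, and a vector \<open>b\<close> orthogonal to the double \<open>F[w] + F[w] a\<close>. A frame determines the algebra up
  to the norms of \<open>a\<close> and \<open>b\<close>, even semilinearly along a field embedding, so all the conjugacy and
  isomorphism claims amount to producing frames with equal norms. Instead of Witt cancellation one
  uses that the complements of two subalgebras of dimension at most \<open>4\<close> always meet, as both lie in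
  the hyperplane orthogonal to \<open>1\<close>; over a field with a primitive cube root of \<open>1\<close> the Zorn algebra
  has explicit frames of arbitrary norms on which \<open>tau_st\<close> acts as required.
\<close>

section \<open>Hurwitz algebras and Cayley-Dickson doubling\<close>

lemma (in vector_space) independent_Un:
  assumes S: "independent S" and T: "independent T" and disj: "span S \<inter> span T = {0}"
  shows "independent (S \<union> T)"
  unfolding independent_explicit_finite_subsets
proof (intro allI impI)
  fix R u
  assume R: "R \<subseteq> S \<union> T" "finite R" and eq: "(\<Sum>v\<in>R. scale (u v) v) = 0"
  have sp: "(\<Sum>v\<in>R \<inter> S. scale (u v) v) \<in> span S" "(\<Sum>v\<in>R - S. scale (u v) v) \<in> span T"
    using R by (intro span_sum span_scale span_base; blast)+
  have "(\<Sum>v\<in>R \<inter> S. scale (u v) v) + (\<Sum>v\<in>R - S. scale (u v) v) = 0"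
    using eq R(2) by (metis sum.Int_Diff)
  then have neg: "(\<Sum>v\<in>R \<inter> S. scale (u v) v) = - (\<Sum>v\<in>R - S. scale (u v) v)"
    by (simp add: eq_neg_iff_add_eq_0)
  then have "(\<Sum>v\<in>R \<inter> S. scale (u v) v) \<in> span S \<inter> span T"
    using sp span_neg by auto
  then have zero: "(\<Sum>v\<in>R \<inter> S. scale (u v) v) = 0" "(\<Sum>v\<in>R - S. scale (u v) v) = 0"
    using disj neg by auto
  have "R \<inter> S \<subseteq> S" "finite (R \<inter> S)" "R - S \<subseteq> T" "finite (R - S)" using R by blast+
  then have "\<forall>v\<in>R \<inter> S. u v = 0" "\<forall>v\<in>R - S. u v = 0"
    using independentD[OF S] independentD[OF T] zero by metis+
  then show "\<forall>v\<in>R. u v = 0" by blast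
qed

section \<open>Bilinear identities in a unital composition algebra\<close>

locale unital_composition = hurwitz_algebra smul UNIV mul n e
  for smul :: "'f::field \<Rightarrow> 'a::ab_group_add \<Rightarrow> 'a" (infixr "\<star>" 75)
    and mul :: "'a \<Rightarrow> 'a \<Rightarrow> 'a" (infixl "\<cdot>" 70) and n :: "'a \<Rightarrow> 'f" and e :: 'a
begin

abbreviation B :: "'a \<Rightarrow> 'a \<Rightarrow> 'f" where "B \<equiv> polar n"

abbreviation bar :: "'a \<Rightarrow> 'a" where "bar \<equiv> conjugation smul n e"

lemma mul_add_left: "(x + y) \<cdot> z = x \<cdot> z + y \<cdot> z"
  by (simp add: mult_add_left)

lemma mul_add_right: "x \<cdot> (y + z) = x \<cdot> y + x \<cdot> z"
  by (simp add: mult_add_right)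

lemma mul_scale_left [simp]: "(a \<star> x) \<cdot> y = a \<star> (x \<cdot> y)"
  by (simp add: mult_scale_left)

lemma mul_scale_right [simp]: "x \<cdot> (a \<star> y) = a \<star> (x \<cdot> y)"
  by (simp add: mult_scale_right)

lemma mul_zero_left [simp]: "0 \<cdot> x = 0"
  using mul_scale_left[of 0 0 x] by simp

lemma mul_zero_right [simp]: "x \<cdot> 0 = 0"
  using mul_scale_right[of x 0 0] by simp

lemma mul_minus_left [simp]: "(- x) \<cdot> y = - (x \<cdot> y)"
  using mul_scale_left[of "-1" x y] by simp

lemma mul_minus_right [simp]: "x \<cdot> (- y) = - (x \<cdot> y)"
  using mul_scale_right[of x "-1" y] by simp

lemma mul_diff_left: "(x - y) \<cdot> z = x \<cdot> z - y \<cdot> z"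
  using mul_add_left[of x "- y" z] by simp

lemma mul_diff_right: "x \<cdot> (y - z) = x \<cdot> y - x \<cdot> z"
  using mul_add_right[of x y "- z"] by simp

lemmas mul_linear = mul_add_left mul_add_right mul_diff_left mul_diff_right

lemma unit_left [simp]: "e \<cdot> x = x" and unit_right [simp]: "x \<cdot> e = x"
  by (simp_all add: one_left one_right)

lemma n_scale [simp]: "n (a \<star> x) = a\<^sup>2 * n x"
  by (simp add: norm_scale)

lemma n_mul [simp]: "n (x \<cdot> y) = n x * n y"
  by (simp add: norm_mult)

lemma n_zero [simp]: "n 0 = 0"
  using n_scale[of 0 0] by simp

lemma n_minus [simp]: "n (- x) = n x"
  using n_scale[of "-1" x] by simp

lemma n_add: "n (x + y) = n x + n y + B x y"
  by (simp add: polar_def)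

lemma B_commute: "B x y = B y x"
  by (simp add: polar_def add.commute)

lemma B_add_left: "B (x + y) z = B x z + B y z"
  by (simp add: polar_add_left)

lemma B_add_right: "B z (x + y) = B z x + B z y"
  by (simp add: B_commute[of z] B_add_left)

lemma B_scale_left [simp]: "B (a \<star> x) y = a * B x y"
  by (simp add: polar_scale_left)

lemma B_scale_right [simp]: "B x (a \<star> y) = a * B x y"
  by (simp add: B_commute[of x])

lemma B_zero [simp]: "B 0 x = 0" "B x 0 = 0"
  using B_scale_left[of 0 0 x] B_scale_right[of x 0 0] by simp_all

lemma B_minus [simp]: "B (- x) y = - B x y" "B x (- y) = - B x y"
  using B_scale_left[of "-1" x y] B_scale_right[of x "-1" y] by simp_all

lemma B_diff_left: "B (x - y) z = B x z - B y z"
  using B_add_left[of x "- y" z] by simp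

lemma B_diff_right: "B z (x - y) = B z x - B z y"
  using B_add_right[of z x "- y"] by simp

lemmas B_linear = B_add_left B_add_right B_diff_left B_diff_right

lemma B_self: "B x x = 2 * n x"
proof -
  have "n (x + x) = 2\<^sup>2 * n x"
    by (metis n_scale one_add_one scale_left_distrib scale_one)
  then show ?thesis by (simp add: polar_def)
qed

lemma n_diff: "n (x - y) = n x + n y - B x y"
  using n_add[of x "- y"] by simp

lemma B_mul_right: "B (x \<cdot> z) (y \<cdot> z) = B x y * n z"
proof -
  have "n ((x + y) \<cdot> z) = n (x + y) * n z" by simp
  then show ?thesis by (simp add: polar_def mul_add_left algebra_simps)
qed

lemma B_mul_left: "B (z \<cdot> x) (z \<cdot> y) = n z * B x y"
proof -
  have "n (z \<cdot> (x + y)) = n z * n (x + y)" by simp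
  then show ?thesis by (simp add: polar_def mul_add_right algebra_simps)
qed

text \<open>Full linearization of the multiplicativity of the norm: \<open>B_mul_right\<close> is
  polarized in its last argument. Putting \<open>e\<close> for \<open>z\<close> or for
  \<open>t\<close> yields the two adjunction rules below.\<close>

lemma B_mul_exchange: "B (x \<cdot> y) (z \<cdot> t) + B (x \<cdot> t) (z \<cdot> y) = B x z * B y t"
  using B_mul_right[of x "y + t" z] B_mul_right[of x y z] B_mul_right[of x t z]
  by (simp add: mul_add_right B_linear n_add B_commute[of t y] algebra_simps)

lemma bar_def: "bar x = B x e \<star> e - x"
  by (simp add: conjugation_def)

lemma B_adjoint_left: "B (x \<cdot> y) z = B y (bar x \<cdot> z)"
  using B_mul_exchange[of x y e z]
  by (simp add: bar_def mul_linear B_linear B_commute[of "x \<cdot> z" y] eq_diff_eq)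

lemma B_adjoint_right: "B (x \<cdot> y) z = B x (z \<cdot> bar y)"
  using B_mul_exchange[of x y z e]
  by (simp add: bar_def mul_linear B_linear B_commute[of x] B_commute[of y] algebra_simps)

lemma bar_add: "bar (x + y) = bar x + bar y"
  and bar_scale [simp]: "bar (a \<star> x) = a \<star> bar x"
  and bar_minus [simp]: "bar (- x) = - bar x"
  by (simp_all add: bar_def B_linear algebra_simps)

end

text \<open>Nonsingularity still admits a one-dimensional radical;
  \<open>polar_radical_trivial\<close> rules it out in dimension 8. With \<open>B\<close>
  nondegenerate, an identity between vectors may be checked after pairing with an arbitrary vector,
  as in \<open>B_eqI\<close>.\<close>

locale nonsingular_hurwitz = unital_composition +
  assumes B_nondegenerate: "(\<And>y. B x y = 0) \<Longrightarrow> x = 0"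
    and unit_nonzero: "e \<noteq> 0"
begin

lemma B_eqI: "(\<And>z. B x z = B y z) \<Longrightarrow> x = y"
  using B_nondegenerate[of "x - y"] by (simp add: B_linear)

lemma n_unit [simp]: "n e = 1"
proof -
  have "n e * n e = n e" using n_mul[of e e] by simp
  moreover have "n e \<noteq> 0"
  proof
    assume "n e = 0"
    then have "n x = 0" for x using n_mul[of e x] by simp
    then have "B e y = 0" for y by (simp add: polar_def)
    then show False using B_nondegenerate unit_nonzero by blast
  qed
  ultimately show ?thesis by simp
qed

lemma B_unit_unit: "B e e = 2" by (simp add: B_self)

lemma bar_unit [simp]: "bar e = e"
  by (simp add: bar_def B_unit_unit algebra_simps flip: scale_left_distrib)
    (metis one_add_one scale_left_distrib scale_one)

lemma B_bar_unit [simp]: "B (bar x) e = B x e"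
  by (simp add: bar_def B_linear B_unit_unit)

lemma bar_bar [simp]: "bar (bar x) = x"
  by (simp add: bar_def[of "bar x"]) (simp add: bar_def)

lemma n_bar [simp]: "n (bar x) = n x"
  by (simp add: bar_def n_diff B_commute[of e x] power2_eq_square)

lemma B_bar_bar [simp]: "B (bar x) (bar y) = B x y"
  using n_bar[of "x + y"] by (simp add: bar_add n_add)

lemma B_bar_swap: "B (bar x) y = B x (bar y)"
  using B_bar_bar[of "x" "bar y"] by simp

text \<open>Paired with \<open>z\<close>, the left side becomes
  \<open>B (x \<cdot> y) (x \<cdot> z)\<close> by adjunction, which is \<open>n x * B y z\<close>.
  This stands in for associativity: the left linearization and the left alternative law come from
  it.\<close>

lemma bar_mul_cancel [simp]: "bar x \<cdot> (x \<cdot> y) = n x \<star> y"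
  by (rule B_eqI) (simp add: B_adjoint_left[of "bar x"] B_mul_left)

lemma mul_bar_cancel [simp]: "x \<cdot> (bar x \<cdot> y) = n x \<star> y"
  using bar_mul_cancel[of "bar x"] by simp

lemma mul_bar_cancel_right [simp]: "(y \<cdot> x) \<cdot> bar x = n x \<star> y"
  by (rule B_eqI) (simp add: B_adjoint_right[of _ "bar x"] B_mul_right)

lemma bar_mul_cancel_right [simp]: "(y \<cdot> bar x) \<cdot> x = n x \<star> y"
  using mul_bar_cancel_right[of y "bar x"] by simp

lemma bar_mul_self [simp]: "bar x \<cdot> x = n x \<star> e" and mul_bar_self [simp]: "x \<cdot> bar x = n x \<star> e"
  using bar_mul_cancel[of x e] mul_bar_cancel[of x e] by simp_all

lemma left_linearized: "x \<cdot> (bar y \<cdot> z) + y \<cdot> (bar x \<cdot> z) = B x y \<star> z"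
  using mul_bar_cancel[of "x + y" z]
  by (simp add: bar_add mul_linear n_add algebra_simps)

lemma right_linearized: "(z \<cdot> x) \<cdot> bar y + (z \<cdot> y) \<cdot> bar x = B x y \<star> z"
  using mul_bar_cancel_right[of z "x + y"]
  by (simp add: bar_add mul_linear n_add algebra_simps)

lemma bar_mul: "bar (x \<cdot> y) = bar y \<cdot> bar x"
proof (rule B_eqI)
  fix z
  have "B (bar (x \<cdot> y)) z = B (x \<cdot> y) (bar z)" by (rule B_bar_swap)
  also have "\<dots> = B y (bar x \<cdot> bar z)" by (rule B_adjoint_left)
  also have "\<dots> = B (bar x \<cdot> bar z) y" by (rule B_commute)
  also have "\<dots> = B (bar x) (y \<cdot> z)" by (simp add: B_adjoint_right)
  also have "\<dots> = B (bar y \<cdot> bar x) z" by (simp add: B_adjoint_left[of "bar y"])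
  finally show "B (bar (x \<cdot> y)) z = B (bar y \<cdot> bar x) z" .
qed

lemma mul_self: "x \<cdot> x = B x e \<star> x - n x \<star> e"
  using bar_mul_self[of x] by (simp only: bar_def mul_linear) (simp add: algebra_simps)

lemma left_alternative: "x \<cdot> (x \<cdot> y) = (x \<cdot> x) \<cdot> y"
  using bar_mul_cancel[of x y] by (simp only: bar_def mul_self mul_linear) (simp add: algebra_simps)

lemma mul_bar_mul: "x \<cdot> (bar y \<cdot> x) = B x y \<star> x - n x \<star> y"
  using left_linearized[of x y x] by (simp add: algebra_simps)

lemma mul_left_cancel: "n x \<noteq> 0 \<Longrightarrow> x \<cdot> y = x \<cdot> z \<Longrightarrow> y = z"
  by (metis bar_mul_cancel scale_left_imp_eq)

lemma mul_right_cancel: "n x \<noteq> 0 \<Longrightarrow> y \<cdot> x = z \<cdot> x \<Longrightarrow> y = z"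
  by (metis mul_bar_cancel_right scale_left_imp_eq)

section \<open>Regular subalgebras and orthogonal complements\<close>

definition perp :: "'b set \<Rightarrow> 'b set" where
  "perp D = {x. \<forall>y\<in>D. B x y = 0}"

text \<open>
  Regularity of the norm on \<open>D\<close> is expressed by the existence of orthogonal projections onto \<open>D\<close>.
  Unlike nondegeneracy, this passes to doubles and to \<open>Fix \<tau>\<close> by explicit formulas, without any
  dimension count.
\<close>

definition regular_subalgebra :: "'b set \<Rightarrow> bool" where
  "regular_subalgebra D \<longleftrightarrow> subspace D \<and> e \<in> D \<and> (\<forall>x\<in>D. \<forall>y\<in>D. x \<cdot> y \<in> D) \<and>
     (\<forall>x. \<exists>d\<in>D. x - d \<in> perp D)"

definition bar_submonoid :: "'b set \<Rightarrow> bool" where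
  "bar_submonoid D \<longleftrightarrow> e \<in> D \<and> (\<forall>x\<in>D. \<forall>y\<in>D. x \<cdot> y \<in> D) \<and> (\<forall>x\<in>D. bar x \<in> D)"

definition double :: "'b set \<Rightarrow> 'b \<Rightarrow> 'b set" where
  "double D b = {p + q \<cdot> b | p q. p \<in> D \<and> q \<in> D}"

lemma perpD: "x \<in> perp D \<Longrightarrow> y \<in> D \<Longrightarrow> B x y = 0" "x \<in> perp D \<Longrightarrow> y \<in> D \<Longrightarrow> B y x = 0"
  by (auto simp: perp_def B_commute)

lemma perp_antimono: "D \<subseteq> E \<Longrightarrow> perp E \<subseteq> perp D"
  by (auto simp: perp_def)

lemma subspace_perp: "subspace (perp D)"
  by (rule subspaceI) (auto simp: perp_def B_linear)

lemma regular_UNIV: "regular_subalgebra UNIV"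
  unfolding regular_subalgebra_def perp_def by (auto intro: bexI[where x = "x" for x])
    (metis B_zero(1) diff_self)

context
  fixes D assumes D: "regular_subalgebra D"
begin

lemma regular_subspace: "subspace D" and regular_unit: "e \<in> D"
  and regular_mul: "x \<in> D \<Longrightarrow> y \<in> D \<Longrightarrow> x \<cdot> y \<in> D"
  using D by (auto simp: regular_subalgebra_def)

lemma regular_decompose: obtains d where "d \<in> D" "x - d \<in> perp D"
  using D unfolding regular_subalgebra_def by blast

lemmas regular_closed = subspace_add[OF regular_subspace] subspace_diff[OF regular_subspace]
  subspace_scale[OF regular_subspace] subspace_neg[OF regular_subspace] subspace_0[OF regular_subspace]
  regular_unit regular_mul

lemma regular_bar: "x \<in> D \<Longrightarrow> bar x \<in> D"
  by (simp add: bar_def regular_closed)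

lemma regular_bar_submonoid: "bar_submonoid D"
  by (simp add: bar_submonoid_def regular_closed regular_bar)

lemma regular_perp_Int: "x \<in> D \<Longrightarrow> x \<in> perp D \<Longrightarrow> x = 0"
proof (rule B_nondegenerate)
  fix y assume x: "x \<in> D" "x \<in> perp D"
  obtain d where "d \<in> D" "y - d \<in> perp D" by (rule regular_decompose)
  then have "B x d = 0" "B x (y - d) = 0" using x perpD by blast+
  then show "B x y = 0" by (simp add: B_linear)
qed

lemma regular_perp_nondegenerate:
  assumes "x \<in> perp D" "x \<noteq> 0" obtains y where "y \<in> perp D" "B x y \<noteq> 0"
proof -
  obtain t where t: "B x t \<noteq> 0" using assms B_nondegenerate by blast
  obtain d where d: "d \<in> D" "t - d \<in> perp D" by (rule regular_decompose)
  have "B x (t - d) \<noteq> 0" using t d assms perpD by (simp add: B_linear)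
  with d that show ?thesis by blast
qed

text \<open>Supplies the new vector for each doubling. An element of \<open>E\<close> outside
  \<open>D\<close> projects to \<open>z \<noteq> 0\<close>; a vector pairing nontrivially with
  \<open>z\<close> is moved to \<open>t'\<close> in \<open>E\<close> and \<open>perp D\<close>
  without changing the pairing. As \<open>B z t' = n (z + t') - n z - n t'\<close> is nonzero, one
  of the three norms is nonzero.\<close>

lemma anisotropic_in_perp:
  assumes E: "regular_subalgebra E" and "D \<subseteq> E" "D \<noteq> E"
  obtains a where "a \<in> E" "a \<in> perp D" "n a \<noteq> 0"
proof -
  obtain y where y: "y \<in> E" "y \<notin> D" using assms by blast
  obtain d where d: "d \<in> D" "y - d \<in> perp D" by (rule regular_decompose)
  define z where "z = y - d"
  have z: "z \<in> E" "z \<in> perp D" "z \<noteq> 0"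
    using y d \<open>D \<subseteq> E\<close> subspace_diff[of E] E by (auto simp: z_def regular_subalgebra_def)
  obtain t where t: "B z t \<noteq> 0" using B_nondegenerate z(3) by blast
  obtain s where s: "s \<in> E" "t - s \<in> perp E" using E unfolding regular_subalgebra_def by blast
  obtain c where c: "c \<in> D" "s - c \<in> perp D" by (rule regular_decompose)
  define t' where "t' = s - c"
  have t': "t' \<in> E" "t' \<in> perp D"
    using s c \<open>D \<subseteq> E\<close> subspace_diff[of E] E by (auto simp: t'_def regular_subalgebra_def)
  have "B z t' = B z t"
    using perpD(2)[OF s(2) z(1)] perpD(1)[OF z(2) c(1)] by (simp add: t'_def B_linear)
  with t have nz: "B z t' \<noteq> 0" by simp
  have "z + t' \<in> E" "z + t' \<in> perp D"
    using z t' E subspace_add subspace_perp by (auto simp: regular_subalgebra_def)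
  moreover have "n z \<noteq> 0 \<or> n t' \<noteq> 0 \<or> n (z + t') \<noteq> 0" using nz by (auto simp: n_add)
  ultimately show ?thesis using that z t' by blast
qed

end

text \<open>
  The rules of the Cayley-Dickson process do not need \<open>D\<close> to be a subspace; below it is also the
  image of a subalgebra under a semilinear map, hence only a subspace over the smaller field.
\<close>

context
  fixes D b assumes D: "bar_submonoid D" and b: "b \<in> perp D"
begin

lemma submonoid_closed: "e \<in> D" "x \<in> D \<Longrightarrow> y \<in> D \<Longrightarrow> x \<cdot> y \<in> D" "x \<in> D \<Longrightarrow> bar x \<in> D"
  using D by (auto simp: bar_submonoid_def)

lemma bar_perp: "bar b = - b"
  using perpD(1)[OF b submonoid_closed(1)] by (simp add: bar_def)

lemma perp_mul_commute: "p \<in> D \<Longrightarrow> b \<cdot> p = bar p \<cdot> b"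
  using left_linearized[of b "bar p" e] perpD(1)[OF b submonoid_closed(3), of p]
  by (simp add: bar_perp)

lemma double_mul_inner_outer:
  assumes "p \<in> D" "q \<in> D" shows "p \<cdot> (q \<cdot> b) = (q \<cdot> p) \<cdot> b"
proof -
  \<comment> \<open>\<open>p\<close> is orthogonal to \<open>- b\<close>, so the linearized
    cancellation law has right side 0; the sign is there because
    \<open>bar (- b) = b\<close>.\<close>
  have "p \<cdot> (bar (- b) \<cdot> bar q) + (- b) \<cdot> (bar p \<cdot> bar q) = 0"
    using left_linearized[of p "- b" "bar q"] perpD(2)[OF b assms(1)] by simp
  then have "p \<cdot> (b \<cdot> bar q) = b \<cdot> bar (q \<cdot> p)" by (simp add: bar_perp bar_mul)
  then show ?thesis
    using assms by (simp add: perp_mul_commute submonoid_closed)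
qed

lemma double_mul_outer_inner:
  assumes "q \<in> D" "r \<in> D" shows "(q \<cdot> b) \<cdot> r = (q \<cdot> bar r) \<cdot> b"
  using right_linearized[of q b "bar r"] perpD(1)[OF b submonoid_closed(3), of r] assms
  by (simp add: bar_perp)

lemma perp_mul_left:
  assumes "q \<in> D" shows "q \<cdot> b \<in> perp D"
  using assms by (auto simp: perp_def B_adjoint_left perpD[OF b] submonoid_closed)

lemma bar_perp_mul: "q \<in> D \<Longrightarrow> bar (q \<cdot> b) = - (q \<cdot> b)"
  using perpD(1)[OF perp_mul_left submonoid_closed(1), of q] by (simp add: bar_def)

lemma double_mul_outer_outer:
  assumes "q \<in> D" "s \<in> D"
  shows "(q \<cdot> b) \<cdot> (s \<cdot> b) = - n b \<star> (bar s \<cdot> q)"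
proof -
  have "(q \<cdot> b) \<cdot> (bar (bar s) \<cdot> b) + bar s \<cdot> (bar (q \<cdot> b) \<cdot> b) = 0"
    using left_linearized[of "q \<cdot> b" "bar s" b]
      perpD(1)[OF perp_mul_left[OF assms(1)] submonoid_closed(3)[OF assms(2)]] by simp
  moreover have "(q \<cdot> b) \<cdot> b = - n b \<star> q"
    using mul_bar_cancel_right[of q b] by (simp add: bar_perp) (metis minus_equation_iff)
  ultimately show ?thesis
    by (simp add: bar_perp_mul[OF assms(1)] eq_neg_iff_add_eq_0)
qed

lemma double_mul:
  assumes "p \<in> D" "q \<in> D" "r \<in> D" "s \<in> D"
  shows "(p + q \<cdot> b) \<cdot> (r + s \<cdot> b) =
    (p \<cdot> r - n b \<star> (bar s \<cdot> q)) + (s \<cdot> p + q \<cdot> bar r) \<cdot> b"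
  using assms
  by (simp add: mul_linear double_mul_inner_outer double_mul_outer_inner double_mul_outer_outer
      algebra_simps)

lemma n_double:
  assumes "p \<in> D" "q \<in> D" shows "n (p + q \<cdot> b) = n p + n q * n b"
  using perpD(2)[OF perp_mul_left[OF assms(2)] assms(1)] by (simp add: n_add)

end

section \<open>Regularity and bases of Cayley-Dickson doubles\<close>

context
  fixes D b assumes D: "regular_subalgebra D" and b: "b \<in> perp D" and nb: "n b \<noteq> 0"
begin

lemma double_decomposition_unique:
  assumes "p \<in> D" "q \<in> D" "r \<in> D" "s \<in> D" "p + q \<cdot> b = r + s \<cdot> b"
  shows "p = r" "q = s"
proof -
  have sub: "bar_submonoid D" by (rule regular_bar_submonoid[OF D])
  have eq: "p - r = (s - q) \<cdot> b" using assms(5) by (simp add: mul_linear algebra_simps)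
  have "s - q \<in> D" "p - r \<in> D" using assms by (simp_all add: regular_closed[OF D])
  then have "p - r = 0"
    using regular_perp_Int[OF D] perp_mul_left[OF sub b] eq by metis
  moreover from this have "s - q = 0"
    using eq mul_right_cancel[OF nb, of "s - q" 0] by simp
  ultimately show "p = r" "q = s" by simp_all
qed

lemma subset_double: "D \<subseteq> double D b"
proof
  fix x assume "x \<in> D"
  moreover have "x = x + 0 \<cdot> b" by simp
  ultimately show "x \<in> double D b"
    unfolding double_def using regular_closed(5)[OF D] by blast
qed

lemma self_in_double: "b \<in> double D b"
proof -
  have "b = 0 + e \<cdot> b" by simp
  then show ?thesis unfolding double_def using regular_closed(5,6)[OF D] by blast
qed

lemma regular_double: "regular_subalgebra (double D b)"
  unfolding regular_subalgebra_def
proof (intro conjI ballI allI)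
  have sub: "bar_submonoid D" by (rule regular_bar_submonoid[OF D])
  note closed = regular_closed[OF D] regular_bar[OF D]
  show "subspace (double D b)"
  proof (rule subspaceI)
    show "0 \<in> double D b" using subset_double closed by blast
  next
    fix x y assume "x \<in> double D b" "y \<in> double D b"
    then obtain p q r s where "p \<in> D" "q \<in> D" "r \<in> D" "s \<in> D"
      and "x = p + q \<cdot> b" "y = r + s \<cdot> b" by (auto simp: double_def)
    moreover from this have "x + y = (p + r) + (q + s) \<cdot> b" by (simp add: mul_linear algebra_simps)
    ultimately show "x + y \<in> double D b" unfolding double_def using closed by blast
  next
    fix c x assume "x \<in> double D b"
    then obtain p q where "p \<in> D" "q \<in> D" and "x = p + q \<cdot> b" by (auto simp: double_def)
    moreover from this have "c \<star> x = c \<star> p + (c \<star> q) \<cdot> b" by (simp add: algebra_simps)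
    ultimately show "c \<star> x \<in> double D b" unfolding double_def using closed by blast
  qed
  show "e \<in> double D b" using subset_double closed by blast
  show "x \<cdot> y \<in> double D b" if "x \<in> double D b" "y \<in> double D b" for x y
  proof -
    obtain p q r s where mem: "p \<in> D" "q \<in> D" "r \<in> D" "s \<in> D"
      and "x = p + q \<cdot> b" "y = r + s \<cdot> b"
      using \<open>x \<in> double D b\<close> \<open>y \<in> double D b\<close> unfolding double_def by blast
    then have "x \<cdot> y = (p \<cdot> r - n b \<star> (bar s \<cdot> q)) + (s \<cdot> p + q \<cdot> bar r) \<cdot> b"
      using double_mul[OF sub b] by simp
    moreover have "p \<cdot> r - n b \<star> (bar s \<cdot> q) \<in> D" "s \<cdot> p + q \<cdot> bar r \<in> D"
      using mem by (simp_all add: closed)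
    ultimately show ?thesis unfolding double_def by blast
  qed
  show "\<exists>d\<in>double D b. x - d \<in> perp (double D b)" for x
  proof -
    obtain d where d: "d \<in> D" "x - d \<in> perp D" by (rule regular_decompose[OF D])
    \<comment> \<open>The remainder \<open>x - d\<close> is a right multiple of \<open>b\<close>,
      with cofactor \<open>inverse (n b) \<star> ((x - d) \<cdot> bar b)\<close>. Projecting the
      cofactor to \<open>D\<close> gives the coefficient of \<open>b\<close> in the projection of
      \<open>x\<close> to the double.\<close>
    obtain c where c: "c \<in> D" "inverse (n b) \<star> ((x - d) \<cdot> bar b) - c \<in> perp D"
      by (rule regular_decompose[OF D])
    define y where "y = inverse (n b) \<star> ((x - d) \<cdot> bar b) - c"
    have "y \<cdot> b = (x - d) - c \<cdot> b" using nb by (simp add: y_def mul_linear scale_right_diff_distrib)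
    then have xy: "x - (d + c \<cdot> b) = y \<cdot> b" by simp
    have "B (y \<cdot> b) (p + q \<cdot> b) = 0" if "p \<in> D" "q \<in> D" for p q
    proof -
      have "B (y \<cdot> b) (q \<cdot> b) = 0"
        using perpD(1)[OF c(2) that(2)] by (simp add: B_mul_right flip: y_def)
      moreover have "y \<cdot> b \<in> perp D"
        using \<open>y \<cdot> b = _\<close> d(2) perp_mul_left[OF sub b c(1)] subspace_diff[OF subspace_perp] by simp
      ultimately show ?thesis using perpD(1) that by (simp add: B_linear)
    qed
    then have "x - (d + c \<cdot> b) \<in> perp (double D b)"
      unfolding xy by (auto simp: perp_def double_def)
    then show ?thesis using c d unfolding double_def by blast
  qed
qed

lemma basis_double:
  assumes S: "independent S" "span S = D"
  shows "independent (S \<union> (\<lambda>x. x \<cdot> b) ` S)" "span (S \<union> (\<lambda>x. x \<cdot> b) ` S) = double D b"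
    "card (S \<union> (\<lambda>x. x \<cdot> b) ` S) = 2 * card S"
proof -
  have lin: "Vector_Spaces.linear smul smul (\<lambda>x. x \<cdot> b)"
    by (simp add: module_hom_iff_linear[symmetric] module_hom_iff mul_linear module_axioms)
  interpret R: Vector_Spaces.linear smul smul "\<lambda>x. x \<cdot> b" by (rule lin)
  have inj: "inj (\<lambda>x. x \<cdot> b)" using mul_right_cancel[OF nb] by (auto intro: injI)
  have sub: "bar_submonoid D" by (rule regular_bar_submonoid[OF D])
  have disj: "x = 0" if "x \<in> span S" "x \<in> span ((\<lambda>x. x \<cdot> b) ` S)" for x
  proof -
    from that(2) obtain q where "q \<in> D" "x = q \<cdot> b" using S by (auto simp: R.span_image)
    then have "x \<in> perp D" using perp_mul_left[OF sub b] by simp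
    then show ?thesis using that(1) S regular_perp_Int[OF D] by simp
  qed
  have indT: "independent ((\<lambda>x. x \<cdot> b) ` S)"
    by (rule R.independent_inj_image[OF S(1) inj])
  show "independent (S \<union> (\<lambda>x. x \<cdot> b) ` S)" (is "independent (S \<union> ?T)")
  proof (rule independent_Un[OF S(1) indT], rule equalityI)
    show "span S \<inter> span ?T \<subseteq> {0}" using disj by blast
    show "{0} \<subseteq> span S \<inter> span ?T" by (simp add: span_zero)
  qed
  show "span (S \<union> ?T) = double D b"
    by (auto simp: span_Un R.span_image S double_def)
  have "S \<inter> ?T = {}"
  proof (rule ccontr)
    assume "S \<inter> ?T \<noteq> {}"
    then obtain x where x: "x \<in> S" "x \<in> ?T" by blast
    then have "x = 0" using disj span_base by metis
    then show False using x(1) S(1) dependent_zero by blast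
  qed
  moreover have "card ?T = card S" by (intro card_image inj_on_subset[OF inj]) simp
  ultimately show "card (S \<union> ?T) = 2 * card S"
    by (cases "finite S") (simp_all add: card_Un_disjoint)
qed

end

end

section \<open>Cube roots of unity and frames\<close>

lemma three_nonzero_iff: "(3 :: 'f::field) \<noteq> 0 \<longleftrightarrow> CHAR('f) \<noteq> 3"
proof
  assume "(3 :: 'f) \<noteq> 0"
  then show "CHAR('f) \<noteq> 3" by (metis of_nat_CHAR of_nat_numeral)
next
  assume neq: "CHAR('f) \<noteq> 3"
  show "(3 :: 'f) \<noteq> 0"
  proof
    assume "(3 :: 'f) = 0"
    then have "of_nat 3 = (0 :: 'f)" by simp
    then have "CHAR('f) dvd 3" by (simp only: of_nat_eq_0_iff_char_dvd)
    moreover have "prime (3 :: nat)" by simp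
    ultimately have "CHAR('f) = 1" using neq by (metis prime_nat_iff)
    then show False using of_nat_CHAR[where 'a = 'f] by simp
  qed
qed

locale hurwitz_char_not_3 = nonsingular_hurwitz smul mul n e
  for smul :: "'f::field \<Rightarrow> 'a::ab_group_add \<Rightarrow> 'a" (infixr "\<star>" 75)
    and mul :: "'a \<Rightarrow> 'a \<Rightarrow> 'a" (infixl "\<cdot>" 70) and n :: "'a \<Rightarrow> 'f" and e :: 'a +
  assumes three_nonzero: "(3 :: 'f) \<noteq> 0"
begin

text \<open>Every element satisfies its quadratic equation \<open>mul_self\<close>, so for a
  nonscalar \<open>w\<close> the equation w^2 + w + 1 = 0 says exactly that the norm is 1 and the
  trace -1.\<close>

definition cube_root :: "'a \<Rightarrow> bool" where
  "cube_root w \<longleftrightarrow> n w = 1 \<and> B w e = - 1"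

definition adjoin :: "'a \<Rightarrow> 'a set" where
  "adjoin w = {a \<star> e + b \<star> w | a b. True}"

lemma cube_root_n [simp]: "cube_root w \<Longrightarrow> n w = 1"
  and cube_root_B: "cube_root w \<Longrightarrow> B w e = - 1" "cube_root w \<Longrightarrow> B e w = - 1"
  by (simp_all add: cube_root_def B_commute[of e])

lemma cube_root_mul_self: "cube_root w \<Longrightarrow> w \<cdot> w = - w - e"
  by (simp add: mul_self cube_root_B)

lemma cube_root_bar: "cube_root w \<Longrightarrow> bar w = - w - e"
  by (simp add: bar_def cube_root_B)

lemma bar_cube_root: "cube_root w \<Longrightarrow> cube_root (bar w)"
  by (simp add: cube_root_def)

text \<open>A scalar with c^2 = 1 and 2c = -1 gives 4 = 1. Characteristic not 3 is essential: in
  characteristic 3 the unit itself has norm 1 and trace -1.\<close>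

lemma cube_root_not_scalar:
  assumes "cube_root w" shows "w \<noteq> c \<star> e"
proof
  assume w: "w = c \<star> e"
  have c2: "c\<^sup>2 = 1" and c: "2 * c = - 1"
    using assms by (simp_all add: w cube_root_def B_unit_unit mult.commute)
  have "(2 * c)\<^sup>2 = 4" by (simp add: power_mult_distrib c2)
  then have "(1 :: 'f) = 4" by (simp add: c)
  moreover have "(3 :: 'f) = 4 - 1" by simp
  ultimately have "(3 :: 'f) = 0" by (metis diff_self)
  then show False using three_nonzero by simp
qed

lemma scale_eq_scale_unit:
  assumes "y \<notin> range (\<lambda>c. c \<star> e)" and eq: "s \<star> y = t \<star> e" shows "s = 0" "t = 0"
proof -
  show "s = 0"
  proof (rule ccontr)
    assume "s \<noteq> 0"
    then have "y = inverse s \<star> (s \<star> y)" by simp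
    then have "y = (inverse s * t) \<star> e" by (simp only: eq scale_scale)
    then show False using assms(1) by blast
  qed
  then show "t = 0" using eq unit_nonzero by simp
qed

lemma primitive_cube_root_iff: "primitive_cube_root smul mul e w \<longleftrightarrow> cube_root w"
proof
  assume w: "primitive_cube_root smul mul e w"
  have "(B w e + 1) \<star> w = (n w - 1) \<star> e"
    using w by (simp add: primitive_cube_root_def mul_self algebra_simps)
  moreover have "w \<notin> range (\<lambda>a. a \<star> e)" using w by (simp add: primitive_cube_root_def)
  ultimately have "B w e + 1 = 0" "n w - 1 = 0" using scale_eq_scale_unit by blast+
  then show "cube_root w"
    by (simp add: cube_root_def eq_neg_iff_add_eq_0)
next
  assume "cube_root w"
  then show "primitive_cube_root smul mul e w"
    unfolding primitive_cube_root_def using cube_root_not_scalar by (auto simp: cube_root_mul_self)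
qed

lemma adjoin_span: "adjoin w = span {e, w}"
  by (auto simp: adjoin_def span_insert span_singleton algebra_simps)

lemma adjoin_eqI: "a \<star> e + b \<star> w = x \<Longrightarrow> x \<in> adjoin w"
  by (auto simp: adjoin_def)

context
  fixes w assumes w: "cube_root w"
begin

lemma adjoin_independent: "independent {e, w}"
  using cube_root_not_scalar[OF w] unit_nonzero
  by (auto simp: independent_insert insert_commute[of e] span_singleton)

lemma adjoin_basis_card: "card {e, w} = 2"
  using cube_root_not_scalar[OF w, of 1] by auto

lemma self_in_adjoin: "w \<in> adjoin w"
  by (rule adjoin_eqI[of 0 1]) simp

lemma regular_adjoin: "regular_subalgebra (adjoin w)"
  unfolding regular_subalgebra_def
proof (intro conjI ballI allI)
  show "subspace (adjoin w)" by (simp add: adjoin_span)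
  show "e \<in> adjoin w" by (rule adjoin_eqI[of 1 0]) simp
  show "x \<cdot> y \<in> adjoin w" if xy: "x \<in> adjoin w" "y \<in> adjoin w" for x y
  proof -
    obtain a b c d where "x = a \<star> e + b \<star> w" "y = c \<star> e + d \<star> w"
      using xy unfolding adjoin_def by blast
    then have "(a * c - b * d) \<star> e + (a * d + b * c - b * d) \<star> w = x \<cdot> y"
      by (simp add: mul_linear cube_root_mul_self[OF w] algebra_simps)
    then show ?thesis by (rule adjoin_eqI)
  qed
  show "\<exists>d\<in>adjoin w. x - d \<in> perp (adjoin w)" for x
  proof
    \<comment> \<open>\<open>a\<close> and \<open>b\<close> solve the linear system for the
      projection: the Gram matrix of \<open>e\<close> and \<open>w\<close> has diagonal entries 2,
      off-diagonal entries -1 and determinant 3.\<close>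
    define a where "a = (2 * B x e + B x w) / 3"
    have "(9 :: 'f) = 3 * 3" by simp
    then have nine: "(9 :: 'f) \<noteq> 0" using three_nonzero by (metis mult_eq_0_iff)
    define b where "b = (B x e + 2 * B x w) / 3"
    show "a \<star> e + b \<star> w \<in> adjoin w" by (rule adjoin_eqI) simp
    have "B (x - (a \<star> e + b \<star> w)) e = 0" "B (x - (a \<star> e + b \<star> w)) w = 0"
      using three_nonzero nine
      by (simp_all add: B_linear B_self cube_root_B[OF w] cube_root_n[OF w] a_def b_def field_simps)
    then show "x - (a \<star> e + b \<star> w) \<in> perp (adjoin w)"
      by (auto simp: perp_def adjoin_def B_add_right)
  qed
qed

lemma adjoin_subset: "regular_subalgebra D \<Longrightarrow> w \<in> D \<Longrightarrow> adjoin w \<subseteq> D"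
  by (auto simp: adjoin_def regular_closed)

lemma adjoin_commute: "x \<in> adjoin w \<Longrightarrow> y \<in> adjoin w \<Longrightarrow> x \<cdot> y = y \<cdot> x"
  by (auto simp: adjoin_def mul_linear algebra_simps)

lemma in_perp_adjoin_iff: "x \<in> perp (adjoin w) \<longleftrightarrow> B x e = 0 \<and> B x w = 0"
  using regular_unit[OF regular_adjoin] self_in_adjoin
  by (auto simp: perp_def adjoin_def B_add_right)

text \<open>The trace condition forces \<open>b = 2 * a + 1\<close>, and the norm condition then
  becomes \<open>3 * (a * (a + 1)) = 0\<close>.\<close>

lemma cube_root_in_adjoin:
  assumes "cube_root u" "u \<in> adjoin w" shows "u = w \<or> u = bar w"
proof -
  obtain a b where u: "u = a \<star> e + b \<star> w" using assms(2) by (auto simp: adjoin_def)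
  have t: "2 * a - b = - 1" and m: "a\<^sup>2 + b\<^sup>2 - a * b = 1"
    using assms(1) by (simp_all add: u cube_root_def B_linear n_add B_unit_unit cube_root_B[OF w]
        cube_root_n[OF w] mult.commute)
  have b: "b = 2 * a + 1" using t by (simp add: algebra_simps)
  have "3 * (a * (a + 1)) = 0" using m unfolding b by (simp add: power2_eq_square algebra_simps)
  then have "a = 0 \<or> a = - 1" using three_nonzero by (auto simp: eq_neg_iff_add_eq_0)
  then show ?thesis by (auto simp: u b cube_root_bar[OF w])
qed

end

section \<open>Frames, their bases and dimensions\<close>

definition frame :: "'a \<Rightarrow> 'a \<Rightarrow> 'a \<Rightarrow> bool" where
  "frame w a b \<longleftrightarrow> cube_root w \<and> a \<in> perp (adjoin w) \<and> n a \<noteq> 0 \<and>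
     b \<in> perp (double (adjoin w) a) \<and> n b \<noteq> 0"

definition frame_basis :: "'a \<Rightarrow> 'a \<Rightarrow> 'a \<Rightarrow> 'a set" where
  "frame_basis w a b = ({e, w} \<union> (\<lambda>x. x \<cdot> a) ` {e, w}) \<union>
     (\<lambda>x. x \<cdot> b) ` ({e, w} \<union> (\<lambda>x. x \<cdot> a) ` {e, w})"

lemma frame_basis_independent:
  assumes "frame w a b"
  shows "independent (frame_basis w a b)" "card (frame_basis w a b) = 8"
    "span (frame_basis w a b) = double (double (adjoin w) a) b"
proof -
  have w: "cube_root w" and a: "a \<in> perp (adjoin w)" "n a \<noteq> 0"
    and b: "b \<in> perp (double (adjoin w) a)" "n b \<noteq> 0"
    using assms by (auto simp: frame_def)
  note S = basis_double[OF regular_adjoin[OF w] a adjoin_independent[OF w] adjoin_span[symmetric]]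
  note T = basis_double[OF regular_double[OF regular_adjoin[OF w] a] b S(1,2)]
  show "independent (frame_basis w a b)" "span (frame_basis w a b) = double (double (adjoin w) a) b"
    unfolding frame_basis_def by (fact T)+
  show "card (frame_basis w a b) = 8"
    unfolding frame_basis_def T(3) S(3) adjoin_basis_card[OF w] by simp
qed

lemma dim_adjoin: "cube_root w \<Longrightarrow> dim (adjoin w) = 2"
  by (metis adjoin_basis_card adjoin_independent adjoin_span dim_span_eq_card_independent)

lemma dim_double_adjoin:
  assumes "cube_root w" "a \<in> perp (adjoin w)" "n a \<noteq> 0"
  shows "dim (double (adjoin w) a) = 4"
proof -
  note S = basis_double[OF regular_adjoin[OF assms(1)] assms(2,3)
      adjoin_independent[OF assms(1)] adjoin_span[symmetric]]
  show ?thesis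
    using dim_span_eq_card_independent[OF S(1)] unfolding S(2,3) adjoin_basis_card[OF assms(1)]
    by simp
qed

lemma hurwitz_algebra_regular:
  assumes "regular_subalgebra D" shows "hurwitz_algebra smul D mul n e"
proof
  show "subspace D" using assms by (rule regular_subspace)
  have "x = 0" if "x \<in> polar_radical D n" for x
    using that regular_perp_Int[OF assms] by (auto simp: polar_radical_def perp_def)
  moreover have "0 \<in> polar_radical D n" using regular_closed(5)[OF assms] by (simp add: polar_radical_def)
  ultimately have "polar_radical D n = {0}" by blast
  then show "polar_radical D n = {0} \<or>
      dim (polar_radical D n) = 1 \<and> (\<forall>x\<in>polar_radical D n. x \<noteq> 0 \<longrightarrow> n x \<noteq> 0)" ..
qed (use regular_closed[OF assms] in \<open>simp_all add: mul_linear B_add_left\<close>)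

end

section \<open>Automorphisms of order three\<close>

locale order_three_map = hurwitz_char_not_3 smul mul n e
  for smul :: "'f::field \<Rightarrow> 'a::ab_group_add \<Rightarrow> 'a" (infixr "\<star>" 75)
    and mul :: "'a \<Rightarrow> 'a \<Rightarrow> 'a" (infixl "\<cdot>" 70) and n :: "'a \<Rightarrow> 'f" and e :: 'a +
  fixes \<tau> :: "'a \<Rightarrow> 'a"
  assumes order_three: "order_three_automorphism smul mul n \<tau>"
begin

lemma tau_add: "\<tau> (x + y) = \<tau> x + \<tau> y"
  and tau_scale [simp]: "\<tau> (c \<star> x) = c \<star> \<tau> x"
  and tau_mul [simp]: "\<tau> (x \<cdot> y) = \<tau> x \<cdot> \<tau> y"
  and n_tau [simp]: "n (\<tau> x) = n x"
  and tau_cubed [simp]: "\<tau> (\<tau> (\<tau> x)) = x"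
  and tau_nontrivial: "\<tau> \<noteq> id"
  using order_three
  by (simp_all add: order_three_automorphism_def composition_automorphism_def
      composition_isomorphism_def algebra_isomorphism_def fun_eq_iff)

lemma tau_zero [simp]: "\<tau> 0 = 0"
  using tau_scale[of 0 0] by simp

lemma tau_minus [simp]: "\<tau> (- x) = - \<tau> x"
  using tau_scale[of "- 1" x] by simp

lemma tau_diff: "\<tau> (x - y) = \<tau> x - \<tau> y"
  using tau_add[of x "- y"] by simp

lemma tau_unit [simp]: "\<tau> e = e"
proof -
  have "\<tau> e \<cdot> \<tau> (\<tau> (\<tau> e)) = \<tau> (\<tau> (\<tau> e))" by (metis tau_mul unit_left)
  then show ?thesis by simp
qed

lemma B_tau [simp]: "B (\<tau> x) (\<tau> y) = B x y"
  by (simp add: polar_def flip: tau_add)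

lemma tau_bar: "\<tau> (bar x) = bar (\<tau> x)"
  using B_tau[of x e] by (simp add: bar_def tau_diff)

lemma FixD: "x \<in> Fix \<tau> \<Longrightarrow> \<tau> x = x"
  by (simp add: Fix_def)

lemma Fix_neq_UNIV: "Fix \<tau> \<noteq> UNIV"
  using tau_nontrivial by (auto simp: Fix_def fun_eq_iff)

lemma orbit_sum_in_Fix: "x + \<tau> x + \<tau> (\<tau> x) \<in> Fix \<tau>"
  by (simp add: Fix_def tau_add add_ac)

lemma regular_Fix: "regular_subalgebra (Fix \<tau>)"
  unfolding regular_subalgebra_def
proof (intro conjI ballI allI)
  show "subspace (Fix \<tau>)" by (rule subspaceI) (auto simp: Fix_def tau_add)
  show "e \<in> Fix \<tau>" "\<And>x y. x \<in> Fix \<tau> \<Longrightarrow> y \<in> Fix \<tau> \<Longrightarrow> x \<cdot> y \<in> Fix \<tau>"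
    by (auto simp: Fix_def)
  show "\<exists>d\<in>Fix \<tau>. x - d \<in> perp (Fix \<tau>)" for x
  proof
    \<comment> \<open>The projection is the average over the orbit of \<open>\<tau>\<close>,
      available because 3 is invertible.\<close>
    let ?s = "x + \<tau> x + \<tau> (\<tau> x)"
    show "inverse 3 \<star> ?s \<in> Fix \<tau>"
      using orbit_sum_in_Fix[of x] by (simp add: Fix_def)
    have "B (x - inverse 3 \<star> ?s) y = 0" if "y \<in> Fix \<tau>" for y
    proof -
      have "B (\<tau> x) y = B x y" "B (\<tau> (\<tau> x)) y = B x y"
        using B_tau[of x y] B_tau[of "\<tau> x" y] FixD[OF that] by simp_all
      then have "B ?s y = 3 * B x y" by (simp add: B_linear)
      then show ?thesis using three_nonzero by (simp only: B_linear B_scale_left) simp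
    qed
    then show "x - inverse 3 \<star> ?s \<in> perp (Fix \<tau>)" by (simp add: perp_def)
  qed
qed

text \<open>The orbit sum is fixed, and it is orthogonal to \<open>Fix \<tau>\<close> because the
  isometry \<open>\<tau>\<close> maps the complement into itself; regularity leaves only 0.\<close>

lemma perp_Fix_orbit_sum:
  assumes "x \<in> perp (Fix \<tau>)" shows "x + \<tau> x + \<tau> (\<tau> x) = 0"
proof (rule regular_perp_Int[OF regular_Fix orbit_sum_in_Fix])
  have inv: "\<tau> y \<in> perp (Fix \<tau>)" if "y \<in> perp (Fix \<tau>)" for y
    using that B_tau[of y] FixD by (auto simp: perp_def) (metis B_tau FixD)
  show "x + \<tau> x + \<tau> (\<tau> x) \<in> perp (Fix \<tau>)"
    using assms inv subspace_add[OF subspace_perp] by blast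
qed

text \<open>
  The cube root is \<open>u = \<tau>(x) x\<^sup>-\<^sup>1\<close>: its trace is \<open>-1\<close> because \<open>n(x + \<tau> x) = n(\<tau>\<^sup>2 x) = n(x)\<close>, and it
  is fixed because \<open>\<tau>(u) \<tau>(x) = \<tau>\<^sup>2(x) = -(e + u) x = u\<^sup>2 x = u \<tau>(x)\<close>.
\<close>

lemma cube_root_of_perp_Fix:
  assumes x: "x \<in> perp (Fix \<tau>)" and nx: "n x \<noteq> 0"
  obtains u where "u \<in> Fix \<tau>" "cube_root u" "\<tau> x = u \<cdot> x"
proof -
  define u where "u = inverse (n x) \<star> (\<tau> x \<cdot> bar x)"
  have ux: "\<tau> x = u \<cdot> x" using nx by (simp add: u_def)
  have ttx: "\<tau> (\<tau> x) = - (x + \<tau> x)"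
    using perp_Fix_orbit_sum[OF x] by (metis add_eq_0_iff)
  have "n (x + \<tau> x) = n x" by (metis n_minus n_tau ttx)
  then have Bx: "B x (\<tau> x) = - n x" by (simp add: n_add eq_neg_iff_add_eq_0 add_ac)
  have "n u = 1" using nx by (simp add: u_def power2_eq_square field_simps)
  moreover have "B u e = - 1"
    using nx Bx by (simp add: u_def B_adjoint_right[of "\<tau> x"] B_commute[of "\<tau> x" x])
  ultimately have u: "cube_root u" by (simp add: cube_root_def)
  have "\<tau> u \<cdot> \<tau> x = \<tau> (\<tau> x)" by (metis ux tau_mul)
  also have "\<dots> = (u \<cdot> u) \<cdot> x" unfolding ttx by (simp add: ux cube_root_mul_self[OF u] mul_linear)
  also have "\<dots> = u \<cdot> \<tau> x" by (simp add: ux left_alternative)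
  finally have "\<tau> u = u" by (rule mul_right_cancel[rotated]) (simp add: nx)
  then show ?thesis using that u ux by (simp add: Fix_def)
qed

end

section \<open>Frames in dimension eight\<close>

locale cayley_space = hurwitz_char_not_3 smul mul n e
  for smul :: "'f::field \<Rightarrow> 'a::ab_group_add \<Rightarrow> 'a" (infixr "\<star>" 75)
    and mul :: "'a \<Rightarrow> 'a \<Rightarrow> 'a" (infixl "\<cdot>" 70) and n :: "'a \<Rightarrow> 'f" and e :: 'a +
  assumes dim_eight: "dim (UNIV :: 'a set) = 8"
begin

lemma finite_dimensional:
  obtains S where "finite_dimensional_vector_space smul S"
proof -
  obtain S where S: "independent S" "UNIV \<subseteq> span S" "card S = 8"
    using basis_exists[of UNIV] dim_eight by metis
  moreover from S(3) have "finite S" by (intro card_ge_0_finite) simp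
  ultimately have "finite_dimensional_vector_space smul S"
    by unfold_locales auto
  with that show ?thesis .
qed

text \<open>The eight vectors of \<open>frame_basis\<close> are independent, hence span an
  eight-dimensional space.\<close>

lemma double_frame:
  assumes "frame w a b" shows "double (double (adjoin w) a) b = UNIV"
proof -
  obtain S where "finite_dimensional_vector_space smul S" by (rule finite_dimensional)
  then interpret F: finite_dimensional_vector_space smul S .
  note T = frame_basis_independent[OF assms]
  have "card S = 8" using F.dim_UNIV dim_eight by simp
  then have "span (frame_basis w a b) = UNIV"
    using T F.dim_eq_full[of "frame_basis w a b"]
    by (simp add: F.dimension_def dim_eq_card_independent)
  then show ?thesis using T(3) by simp
qed

lemma frame_exists:
  assumes "cube_root w" "a \<in> perp (adjoin w)" "n a \<noteq> 0"
  obtains b where "frame w a b"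
proof -
  have "double (adjoin w) a \<noteq> UNIV"
    using dim_double_adjoin[OF assms] dim_eight by auto
  then obtain b where "b \<in> perp (double (adjoin w) a)" "n b \<noteq> 0"
    using anisotropic_in_perp[OF regular_double[OF regular_adjoin[OF assms(1)] assms(2,3)] regular_UNIV]
    by blast
  with that assms show ?thesis by (simp add: frame_def)
qed

text \<open>A frame generates the algebra, since two doublings exhaust it. Claims about
  homomorphisms thus reduce to the frame vectors and the multiples of \<open>e\<close>.\<close>

lemma frame_induct [consumes 1, case_names add unit cube_root mul inner outer]:
  assumes "frame w a b"
    and "\<And>x y. P x \<Longrightarrow> P y \<Longrightarrow> P (x + y)" and "\<And>c. P (c \<star> e)" and "\<And>c. P (c \<star> w)"
    and "\<And>x y. P x \<Longrightarrow> P y \<Longrightarrow> P (x \<cdot> y)" and "P a" and "P b"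
  shows "P x"
proof -
  have w: "P x" if "x \<in> adjoin w" for x using that assms(2-4) by (auto simp: adjoin_def)
  have a: "P x" if "x \<in> double (adjoin w) a" for x
    using that w assms(2,5,6) unfolding double_def by blast
  obtain p q where "x = p + q \<cdot> b" "p \<in> double (adjoin w) a" "q \<in> double (adjoin w) a"
    using double_frame[OF assms(1)] double_def[of "double (adjoin w) a" b] by blast
  then show ?thesis using a assms(2,5,7) by simp
qed

end

section \<open>Fixed subalgebras of dimension two and four\<close>

locale cayley_order_three = cayley_space smul mul n e + order_three_map smul mul n e \<tau>
  for smul :: "'f::field \<Rightarrow> 'a::ab_group_add \<Rightarrow> 'a" (infixr "\<star>" 75)
    and mul :: "'a \<Rightarrow> 'a \<Rightarrow> 'a" (infixl "\<cdot>" 70) and n :: "'a \<Rightarrow> 'f" and e :: 'a and \<tau>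
begin

text \<open>\<open>\<tau>\<close> is shown to be left multiplication by \<open>u\<close> on the
  complement of \<open>adjoin u\<close>, piece by piece: on \<open>k \<cdot> a\<close>,
  \<open>k \<cdot> b\<close> and \<open>(k \<cdot> a) \<cdot> b\<close> with \<open>k\<close> in
  \<open>adjoin u\<close>. There this agrees with conjugation by \<open>bar u\<close>.\<close>

lemma conjugation_of_Fix_adjoin:
  assumes u: "cube_root u" and Fix: "Fix \<tau> = adjoin u"
    and a: "a \<in> perp (Fix \<tau>)" "n a \<noteq> 0" "\<tau> a = u \<cdot> a"
  shows "conjugation_by_cube_root smul mul e \<tau> (bar u)"
proof -
  let ?D = "adjoin u" let ?E = "double ?D a"
  have ap: "a \<in> perp ?D" using a Fix by simp
  note D = regular_bar_submonoid[OF regular_adjoin[OF u]]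
  note rE = regular_double[OF regular_adjoin[OF u] ap a(2)]
  note E = regular_bar_submonoid[OF rE]
  have uD: "u \<in> ?D" using self_in_adjoin[OF u] .
  have aE: "a \<in> ?E" using self_in_double[OF regular_adjoin[OF u] ap a(2)] .
  have DE: "?D \<subseteq> ?E" using subset_double[OF regular_adjoin[OF u] ap a(2)] .
  obtain b where fr: "frame u a b" using frame_exists[OF u ap a(2)] .
  then have b: "b \<in> perp ?E" "n b \<noteq> 0" by (simp_all add: frame_def)
  have bD: "b \<in> perp ?D" using perp_antimono[OF DE] b by blast
  have fixed: "\<tau> k = k" if "k \<in> ?D" for k using that FixD Fix by blast
  have tb: "\<tau> b = u \<cdot> b"
  proof -
    obtain v where v: "v \<in> ?D" "cube_root v" "\<tau> b = v \<cdot> b"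
      using cube_root_of_perp_Fix[of b] bD b Fix by metis
    \<comment> \<open>The only alternative to \<open>v = u\<close>. It would make
      \<open>a \<cdot> b\<close> a fixed vector orthogonal to the fixed subalgebra, hence 0,
      although its norm is nonzero.\<close>
    have "v \<noteq> bar u"
    proof
      assume "v = bar u"
      then have "\<tau> (a \<cdot> b) = (u \<cdot> a) \<cdot> (bar u \<cdot> b)" using v a by simp
      also have "\<dots> = (bar u \<cdot> (u \<cdot> a)) \<cdot> b"
        using uD DE aE by (intro double_mul_inner_outer[OF E b(1)] submonoid_closed[OF E b(1)]) auto
      also have "\<dots> = a \<cdot> b" using u by simp
      finally have "a \<cdot> b \<in> ?D" unfolding Fix[symmetric] by (simp only: Fix_def mem_Collect_eq)
      moreover have "a \<cdot> b \<in> perp ?D"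
        using perp_mul_left[OF E b(1) aE] perp_antimono[OF DE] by blast
      ultimately have "a \<cdot> b = 0" using regular_perp_Int[OF regular_adjoin[OF u]] by blast
      then have "n (a \<cdot> b) = 0" by simp
      then show False using a b by simp
    qed
    then show ?thesis using cube_root_in_adjoin[OF u v(2,1)] v by simp
  qed
  have uu: "bar u \<cdot> bar u = u" "u \<cdot> u = bar u"
    by (simp_all add: cube_root_mul_self[OF u] cube_root_bar[OF u] mul_linear)
  \<comment> \<open>Right multiplication by \<open>u\<close> sends \<open>(bar u \<cdot> x)\<close>
    to \<open>(bar u \<cdot> bar u) \<cdot> x\<close> on the complement, and
    \<open>bar u \<cdot> bar u = u\<close>.\<close>
  have outer: "\<tau> x = (bar u \<cdot> x) \<cdot> u" if "x \<in> perp ?D" "\<tau> x = u \<cdot> x" for x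
  proof -
    have "x \<cdot> u = bar u \<cdot> x" using perp_mul_commute[OF D that(1)] uD by simp
    moreover have "(bar u \<cdot> x) \<cdot> u = (bar u \<cdot> bar u) \<cdot> x"
      using double_mul_outer_inner[OF D that(1), of "bar u" u] uD submonoid_closed[OF D that(1)] by simp
    ultimately show ?thesis using that by (simp add: uu)
  qed
  have inD: "\<tau> x = (bar u \<cdot> x) \<cdot> u" if "x \<in> ?D" for x
  proof -
    have "bar u \<in> ?D" using submonoid_closed[OF D ap] uD by blast
    then have "bar u \<cdot> x = x \<cdot> bar u" using adjoin_commute[OF u] that by blast
    then show ?thesis using that u by (simp add: fixed)
  qed
  have ka: "\<tau> (k \<cdot> a) = u \<cdot> (k \<cdot> a)" if "k \<in> ?D" for k
  proof -
    have "\<tau> (k \<cdot> a) = k \<cdot> (u \<cdot> a)" using that by (simp add: fixed a)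
    also have "\<dots> = u \<cdot> (k \<cdot> a)"
      using that uD adjoin_commute[OF u] by (simp add: double_mul_inner_outer[OF D ap])
    finally show ?thesis .
  qed
  have kb: "\<tau> (k \<cdot> b) = u \<cdot> (k \<cdot> b)" if "k \<in> ?D" for k
  proof -
    have "\<tau> (k \<cdot> b) = k \<cdot> (u \<cdot> b)" using that by (simp add: fixed tb)
    also have "\<dots> = u \<cdot> (k \<cdot> b)"
      using that uD adjoin_commute[OF u] by (simp add: double_mul_inner_outer[OF D bD])
    finally show ?thesis .
  qed
  \<comment> \<open>Here \<open>u\<close> enters twice, as \<open>u \<cdot> u = bar u\<close>.
    Commuting it past \<open>k \<cdot> a\<close> and then moving it out of the product with
    \<open>b\<close> leaves a single left factor \<open>u\<close>.\<close>
  have kab: "\<tau> ((k \<cdot> a) \<cdot> b) = u \<cdot> ((k \<cdot> a) \<cdot> b)" if k: "k \<in> ?D" for k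
  proof -
    have kaE: "k \<cdot> a \<in> ?E" "u \<in> ?E" "u \<cdot> (k \<cdot> a) \<in> ?E"
      using k aE uD DE by (auto intro!: regular_mul[OF rE])
    have "\<tau> ((k \<cdot> a) \<cdot> b) = (u \<cdot> (k \<cdot> a)) \<cdot> (u \<cdot> b)" by (simp add: ka[OF k, simplified] tb)
    also have "\<dots> = (u \<cdot> (u \<cdot> (k \<cdot> a))) \<cdot> b"
      using kaE by (intro double_mul_inner_outer[OF E b(1)])
    also have "u \<cdot> (u \<cdot> (k \<cdot> a)) = (k \<cdot> a) \<cdot> u"
      using perp_mul_commute[OF D perp_mul_left[OF D ap k] uD] by (simp add: left_alternative uu)
    also have "((k \<cdot> a) \<cdot> u) \<cdot> b = u \<cdot> ((k \<cdot> a) \<cdot> b)"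
      using kaE by (simp add: double_mul_inner_outer[OF E b(1)])
    finally show ?thesis .
  qed
  have qb: "\<tau> (q \<cdot> b) = u \<cdot> (q \<cdot> b)" if q: "q \<in> ?E" for q
  proof -
    obtain k l where "q = k + l \<cdot> a" "k \<in> ?D" "l \<in> ?D" using q unfolding double_def by blast
    then show ?thesis using kb kab by (simp only: mul_linear tau_add)
  qed
  have "\<tau> x = (bar u \<cdot> x) \<cdot> u" for x
  proof -
    obtain p q where "x = p + q \<cdot> b" "p \<in> ?E" and q: "q \<in> ?E"
      using double_frame[OF fr] double_def[of ?E b] by blast
    moreover from this obtain k l where "p = k + l \<cdot> a" "k \<in> ?D" "l \<in> ?D"
      unfolding double_def by blast
    ultimately have x: "x = k + l \<cdot> a + q \<cdot> b" "k \<in> ?D" "l \<in> ?D" "q \<in> ?E" by simp_all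
    have "\<tau> (l \<cdot> a) = (bar u \<cdot> (l \<cdot> a)) \<cdot> u"
      using outer[OF perp_mul_left[OF D ap x(3)] ka[OF x(3)]] .
    moreover have "\<tau> (q \<cdot> b) = (bar u \<cdot> (q \<cdot> b)) \<cdot> u"
      using outer[OF _ qb[OF x(4)]] perp_mul_left[OF E b(1) x(4)] perp_antimono[OF DE] by blast
    ultimately show ?thesis using inD[OF x(2)] by (simp only: x(1) mul_linear tau_add)
  qed
  then show ?thesis
    by (simp add: conjugation_by_cube_root_def primitive_cube_root_iff bar_cube_root[OF u] uu)
qed

text \<open>Doubling \<open>adjoin u\<close> once inside \<open>Fix \<tau>\<close> reaches dimension
  4. Were that still proper, one more doubling inside \<open>Fix \<tau>\<close> would fill the whole
  algebra, against \<open>\<tau> \<noteq> id\<close>.\<close>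

lemma quaternion_Fix:
  assumes u: "cube_root u" and Fix: "u \<in> Fix \<tau>" "Fix \<tau> \<noteq> adjoin u"
  shows "fixes_quaternion_with_cube_root smul mul n e \<tau>"
proof -
  have sub: "adjoin u \<subseteq> Fix \<tau>" using adjoin_subset[OF u regular_Fix Fix(1)] .
  obtain a where a: "a \<in> Fix \<tau>" "a \<in> perp (adjoin u)" "n a \<noteq> 0"
    using anisotropic_in_perp[OF regular_adjoin[OF u] regular_Fix sub] Fix(2) by metis
  note rE = regular_double[OF regular_adjoin[OF u] a(2,3)]
  have double_sub: "double D c \<subseteq> Fix \<tau>" if "D \<subseteq> Fix \<tau>" "c \<in> Fix \<tau>" for D c
    using that by (auto simp: double_def intro!: regular_closed(1,7)[OF regular_Fix])
  have E: "double (adjoin u) a \<subseteq> Fix \<tau>" using double_sub sub a by blast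
  have "double (adjoin u) a = Fix \<tau>"
  proof (rule ccontr)
    assume "double (adjoin u) a \<noteq> Fix \<tau>"
    then obtain c where c: "c \<in> Fix \<tau>" "c \<in> perp (double (adjoin u) a)" "n c \<noteq> 0"
      using anisotropic_in_perp[OF rE regular_Fix E] by metis
    then have "frame u a c" using u a by (simp add: frame_def)
    then show False using double_frame double_sub[OF E c(1)] Fix_neq_UNIV by blast
  qed
  then have "dim (Fix \<tau>) = 4" using dim_double_adjoin[OF u a(2,3)] by simp
  then have "quaternion_algebra smul (Fix \<tau>) mul n e"
    using hurwitz_algebra_regular[OF regular_Fix]
    by (simp add: quaternion_algebra_def quaternion_algebra_axioms_def)
  then show ?thesis
    using u Fix(1) by (auto simp: fixes_quaternion_with_cube_root_def primitive_cube_root_iff)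
qed

lemma perp_Fix_anisotropic: obtains x where "x \<in> perp (Fix \<tau>)" "n x \<noteq> 0"
proof -
  show ?thesis using anisotropic_in_perp[OF regular_Fix regular_UNIV] Fix_neq_UNIV that by blast
qed

theorem order_three_dichotomy:
  "(\<exists>w. conjugation_by_cube_root smul mul e \<tau> w) \<or> fixes_quaternion_with_cube_root smul mul n e \<tau>"
proof -
  obtain a where a: "a \<in> perp (Fix \<tau>)" "n a \<noteq> 0" by (rule perp_Fix_anisotropic)
  obtain u where u: "u \<in> Fix \<tau>" "cube_root u" "\<tau> a = u \<cdot> a"
    using cube_root_of_perp_Fix[OF a] .
  show ?thesis
    using conjugation_of_Fix_adjoin[OF u(2) _ a u(3)] quaternion_Fix[OF u(2,1)] by blast
qed

end

section \<open>The Petersson algebra of an inner automorphism\<close>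

context hurwitz_char_not_3
begin

lemma cube_root_conjugation:
  assumes "cube_root w"
  shows "x \<in> adjoin w \<Longrightarrow> (w \<cdot> x) \<cdot> bar w = x"
    and "x \<in> perp (adjoin w) \<Longrightarrow> (w \<cdot> x) \<cdot> bar w = bar w \<cdot> x"
proof -
  note D = regular_bar_submonoid[OF regular_adjoin[OF assms]]
  have w: "w \<in> adjoin w" using self_in_adjoin[OF assms] .
  show "(w \<cdot> x) \<cdot> bar w = x" if "x \<in> adjoin w"
    using adjoin_commute[OF assms w that] assms by simp
  show "(w \<cdot> x) \<cdot> bar w = bar w \<cdot> x" if x: "x \<in> perp (adjoin w)"
  proof -
    have "bar w \<in> adjoin w" using submonoid_closed(3)[OF D x w] .
    then have "(w \<cdot> x) \<cdot> bar w = (w \<cdot> w) \<cdot> x"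
      using double_mul_outer_inner[OF D x w] by simp
    also have "w \<cdot> w = bar w" by (simp add: cube_root_mul_self cube_root_bar assms)
    finally show ?thesis .
  qed
qed

end

context order_three_map
begin

abbreviation star :: "'a \<Rightarrow> 'a \<Rightarrow> 'a" (infixl "\<diamondop>" 70) where
  "star \<equiv> petersson smul mul n e \<tau>"

lemma star_def: "x \<diamondop> y = \<tau> (bar x) \<cdot> \<tau> (\<tau> (bar y))"
  by (simp add: petersson_def)

lemma star_linear: "(x + y) \<diamondop> z = x \<diamondop> z + y \<diamondop> z" "z \<diamondop> (x + y) = z \<diamondop> x + z \<diamondop> y"
  "(c \<star> x) \<diamondop> y = c \<star> (x \<diamondop> y)" "x \<diamondop> (c \<star> y) = c \<star> (x \<diamondop> y)"
  by (simp_all add: star_def bar_add tau_add mul_linear)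

lemma n_star: "n (x \<diamondop> y) = n x * n y"
  by (simp add: star_def)

text \<open>Conjugation reverses products and the cube of \<open>\<tau>\<close> is the identity, so
  the twists combine to \<open>(y \<cdot> z) \<cdot> bar z\<close> or
  \<open>bar z \<cdot> (z \<cdot> y)\<close> with \<open>z\<close> in the
  \<open>\<tau>\<close>-orbit of \<open>x\<close>.\<close>

lemma star_cancel: "(x \<diamondop> y) \<diamondop> x = n x \<star> y" "x \<diamondop> (y \<diamondop> x) = n x \<star> y"
  by (simp_all add: star_def tau_bar[symmetric] bar_mul) (simp_all add: tau_bar)

lemma polar_radical_UNIV: "polar_radical UNIV n = {0}"
  using B_nondegenerate by (auto simp: polar_radical_def)

lemma symmetric_composition_star: "symmetric_composition_algebra smul UNIV star n"
proof
  show "B (x \<diamondop> y) z = B x (y \<diamondop> z)" for x y z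
  proof -
    have "B (x \<diamondop> y) z = B (\<tau> (bar x)) (z \<cdot> \<tau> (\<tau> y))"
      by (simp add: star_def B_adjoint_right[of _ "\<tau> (\<tau> (bar y))"] flip: tau_bar)
    \<comment> \<open>Apply the isometry \<tau>^2 to both arguments; it cancels the
      \<open>\<tau>\<close> in front of \<open>bar x\<close>.\<close>
    also have "\<dots> = B (bar x) (\<tau> (\<tau> z) \<cdot> \<tau> y)"
      using B_tau[of "\<tau> (\<tau> (bar x))" "\<tau> (z \<cdot> \<tau> (\<tau> y))"] B_tau[of "\<tau> (bar x)" "z \<cdot> \<tau> (\<tau> y)"]
      by simp
    also have "\<dots> = B x (y \<diamondop> z)"
      by (simp add: B_bar_swap bar_mul star_def tau_bar)
    finally show ?thesis .
  qed
  show "polar_radical UNIV n = {0} \<or>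
      dim (polar_radical UNIV n) = 1 \<and> (\<forall>x\<in>polar_radical UNIV n. x \<noteq> 0 \<longrightarrow> n x \<noteq> 0)"
    by (simp add: polar_radical_UNIV)
qed (simp_all add: star_linear n_star B_linear)

context
  fixes w assumes conj: "conjugation_by_cube_root smul mul e \<tau> w"
begin

lemma conj_cube_root: "cube_root w"
  using conj by (simp add: conjugation_by_cube_root_def primitive_cube_root_iff)

lemma conj_tau: "x \<in> adjoin w \<Longrightarrow> \<tau> x = x" "x \<in> perp (adjoin w) \<Longrightarrow> \<tau> x = bar w \<cdot> x"
proof -
  have "\<tau> x = (w \<cdot> x) \<cdot> bar w"
    using conj by (simp add: conjugation_by_cube_root_def cube_root_mul_self cube_root_bar conj_cube_root)
  then show "x \<in> adjoin w \<Longrightarrow> \<tau> x = x" "x \<in> perp (adjoin w) \<Longrightarrow> \<tau> x = bar w \<cdot> x"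
    using cube_root_conjugation[OF conj_cube_root] by simp_all
qed

text \<open>A fixed vector \<open>y\<close> of the complement satisfies
  \<open>bar w \<cdot> y = y\<close>, and \<open>bar w - e\<close> has norm 3, so left
  multiplication by it is injective.\<close>

lemma Fix_conj: "Fix \<tau> = adjoin w"
proof
  show "adjoin w \<subseteq> Fix \<tau>" using conj_tau by (auto simp: Fix_def)
  show "Fix \<tau> \<subseteq> adjoin w"
  proof
    fix x assume "x \<in> Fix \<tau>"
    obtain d where d: "d \<in> adjoin w" "x - d \<in> perp (adjoin w)"
      by (rule regular_decompose[OF regular_adjoin[OF conj_cube_root]])
    have "bar w \<cdot> (x - d) = x - d"
      using conj_tau(2)[OF d(2)] conj_tau(1)[OF d(1)] FixD[OF \<open>x \<in> Fix \<tau>\<close>] by (simp add: tau_diff)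
    then have "(bar w - e) \<cdot> (x - d) = (bar w - e) \<cdot> 0"
      by (simp only: mul_diff_left unit_left mul_zero_right) simp
    moreover have "n (bar w - e) = 3"
      by (simp add: n_diff cube_root_B cube_root_n conj_cube_root)
    ultimately have "x - d = 0" using mul_left_cancel three_nonzero by metis
    then show "x \<in> adjoin w" using d by simp
  qed
qed

text \<open>By linearity it suffices to treat \<open>adjoin w\<close>, where \<open>\<tau>\<close>
  is trivial and products commute, and its complement, where \<open>\<tau>\<close> is left
  multiplication by \<open>bar w\<close>.\<close>

lemma star_cube_root: "w \<diamondop> x = B w x \<star> w - x" "x \<diamondop> w = B w x \<star> w - x"
proof -
  note w = conj_cube_root
  note D = regular_bar_submonoid[OF regular_adjoin[OF w]]
  have wD: "w \<in> adjoin w" using self_in_adjoin[OF w] .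
  have bwD: "bar w \<in> adjoin w" using D wD by (simp add: bar_submonoid_def)
  have adj: "w \<diamondop> x = B w x \<star> w - x \<and> x \<diamondop> w = B w x \<star> w - x" if "x \<in> adjoin w" for x
  proof -
    have bx: "bar x \<in> adjoin w" using D that by (simp add: bar_submonoid_def)
    have "w \<diamondop> x = bar w \<cdot> bar x" "x \<diamondop> w = bar w \<cdot> bar x"
      using bx bwD adjoin_commute[OF w bx bwD] by (simp_all add: star_def conj_tau)
    \<comment> \<open>Since \<open>bar w = w \<cdot> w\<close>, one factor can be moved to the
      right, which brings the product into the form of \<open>mul_bar_mul\<close>.\<close>
    moreover have "bar w \<cdot> bar x = w \<cdot> (bar x \<cdot> w)"
      using adjoin_commute[OF w bx wD]
      by (simp add: left_alternative cube_root_mul_self[OF w] cube_root_bar[OF w])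
    ultimately show ?thesis by (simp add: mul_bar_mul w)
  qed
  have per: "w \<diamondop> x = B w x \<star> w - x \<and> x \<diamondop> w = B w x \<star> w - x" if x: "x \<in> perp (adjoin w)" for x
  proof -
    have "bar x = - x" using bar_perp[OF D x] .
    moreover have "\<tau> x = bar w \<cdot> x" using conj_tau(2)[OF x] .
    moreover have "\<tau> (\<tau> x) = w \<cdot> x"
      using conj_tau(2)[OF perp_mul_left[OF D x bwD]] conj_tau(2)[OF x]
      by (simp add: left_alternative cube_root_bar[OF w] cube_root_mul_self[OF w] mul_linear)
    moreover have "(bar w \<cdot> x) \<cdot> bar w = x"
      using double_mul_outer_inner[OF D x bwD bwD] by (simp add: w)
    ultimately show ?thesis
      using perpD(2)[OF x wD] conj_tau(1)[OF bwD] by (simp add: star_def w)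
  qed
  obtain d where "d \<in> adjoin w" "x - d \<in> perp (adjoin w)"
    by (rule regular_decompose[OF regular_adjoin[OF w]])
  then obtain p where x: "x = d + p" and d: "d \<in> adjoin w" "p \<in> perp (adjoin w)"
    by (metis add.commute diff_add_cancel)
  show "w \<diamondop> x = B w x \<star> w - x" "x \<diamondop> w = B w x \<star> w - x"
    by (simp_all add: x adj[OF d(1)] per[OF d(2)] star_linear B_add_right scale_left_distrib)
qed

lemma para_unit_cube_root: "para_unit smul UNIV star n w"
proof -
  have "w \<noteq> 0" using cube_root_n[OF conj_cube_root] n_zero by (metis zero_neq_one)
  moreover have "w \<diamondop> w = w"
    using scale_left_distrib[of 1 1 w] by (simp add: star_cube_root B_self conj_cube_root)
  ultimately show ?thesis
    using symmetric_composition_star star_cube_root by (simp add: para_unit_def)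
qed

text \<open>
  Kaplansky's trick: \<open>x \<bullet> y = (w \<diamondop> x) \<diamondop> (y \<diamondop> w)\<close> is a composition product with unit \<open>w\<close>, and
  \<open>w \<diamondop> x\<close> is its conjugation.
\<close>

lemma para_cayley_star:
  assumes "dim (UNIV :: 'a set) = 8" shows "para_cayley_algebra smul UNIV star n"
proof -
  let ?mul = "\<lambda>x y. (w \<diamondop> x) \<diamondop> (y \<diamondop> w)"
  have ww: "w \<diamondop> w = w" using para_unit_cube_root unfolding para_unit_def by blast
  have comm: "x \<diamondop> w = w \<diamondop> x" for x by (simp add: star_cube_root)
  have cancel: "w \<diamondop> (x \<diamondop> w) = x" "(w \<diamondop> x) \<diamondop> w = x" for x
    by (simp_all add: star_cancel conj_cube_root)
  have "cayley_algebra smul UNIV ?mul n w"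
  proof
    show "?mul w x = x" "?mul x w = x" for x
      by (simp_all only: ww cancel)
    show "polar_radical UNIV n = {0} \<or>
        dim (polar_radical UNIV n) = 1 \<and> (\<forall>x\<in>polar_radical UNIV n. x \<noteq> 0 \<longrightarrow> n x \<noteq> 0)"
      by (simp add: polar_radical_UNIV)
  qed (simp_all add: star_linear n_star B_linear conj_cube_root assms)
  moreover have "x \<diamondop> y = petersson smul ?mul n w id x y" for x y
  proof -
    \<comment> \<open>Conjugation is written as multiplication by \<open>w\<close> on the right for
      \<open>x\<close> and on the left for \<open>y\<close>, so that the factors \<open>w\<close> in
      \<open>?mul\<close> cancel.\<close>
    have "conjugation smul n w x = x \<diamondop> w" "conjugation smul n w y = w \<diamondop> y"
      by (simp_all add: conjugation_def star_cube_root B_commute[of w])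
    then show ?thesis
      by (simp only: petersson_def[of smul ?mul n w id] id_apply cancel)
  qed
  ultimately show ?thesis unfolding para_cayley_algebra_def by blast
qed

lemma quadratic_etale_Fix: "quadratic_etale_algebra smul (Fix \<tau>) mul n e"
  using hurwitz_algebra_regular[OF regular_adjoin] dim_adjoin conj_cube_root
  by (simp add: Fix_conj quadratic_etale_algebra_def quadratic_etale_algebra_axioms_def)

end

end

section \<open>Semilinear embeddings\<close>

context unital_composition
begin

lemma automorphism_unit:
  assumes "composition_automorphism smul mul n f" shows "f e = e"
proof -
  have f: "bij f" "\<And>x y. f (x \<cdot> y) = f x \<cdot> f y"
    using assms by (simp_all add: composition_automorphism_def composition_isomorphism_def
        algebra_isomorphism_def)
  then obtain x where x: "e = f x" by (metis bij_pointE)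
  have "f e \<cdot> f x = f x" using f(2)[of e x] by simp
  then show ?thesis by (metis x unit_right)
qed

end

text \<open>Letting the scalars change along \<open>\<sigma>\<close> treats automorphisms and split
  isomorphisms (\<open>\<sigma>\<close> the identity) together with scalar extension to the
  algebraic closure.\<close>

locale hurwitz_pair = X: hurwitz_char_not_3 smul mul n e + Y: hurwitz_char_not_3 smul' mul' n' e'
  for smul :: "'f::field \<Rightarrow> 'a::ab_group_add \<Rightarrow> 'a" (infixr "\<star>" 75)
    and mul :: "'a \<Rightarrow> 'a \<Rightarrow> 'a" (infixl "\<cdot>" 70) and n :: "'a \<Rightarrow> 'f" and e :: 'a
    and smul' :: "'k::field \<Rightarrow> 'b::ab_group_add \<Rightarrow> 'b" (infixr "\<ast>" 75)
    and mul' :: "'b \<Rightarrow> 'b \<Rightarrow> 'b" (infixl "\<odot>" 70) and n' :: "'b \<Rightarrow> 'k" and e' :: 'b +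
  fixes \<sigma> :: "'f \<Rightarrow> 'k"
  assumes sigma_one [simp]: "\<sigma> 1 = 1"
    and sigma_add: "\<sigma> (a + b) = \<sigma> a + \<sigma> b"
    and sigma_mul [simp]: "\<sigma> (a * b) = \<sigma> a * \<sigma> b"
begin

lemma sigma_zero [simp]: "\<sigma> 0 = 0"
  by (metis add.right_neutral add_left_cancel sigma_add)

lemma sigma_minus [simp]: "\<sigma> (- a) = - \<sigma> a"
  using sigma_add[of "- a" a] by (simp add: eq_neg_iff_add_eq_0)

lemma sigma_diff: "\<sigma> (a - b) = \<sigma> a - \<sigma> b"
  using sigma_add[of a "- b"] by simp

lemma sigma_eq_0: "\<sigma> a = 0 \<longleftrightarrow> a = 0"
  by (metis mult_zero_left right_inverse sigma_mul sigma_one sigma_zero zero_neq_one)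

definition semi_embedding :: "'a set \<Rightarrow> ('a \<Rightarrow> 'b) \<Rightarrow> bool" where
  "semi_embedding D f \<longleftrightarrow> f e = e' \<and>
     (\<forall>x\<in>D. \<forall>y\<in>D. f (x + y) = f x + f y) \<and>
     (\<forall>c. \<forall>x\<in>D. f (c \<star> x) = \<sigma> c \<ast> f x) \<and>
     (\<forall>x\<in>D. \<forall>y\<in>D. f (x \<cdot> y) = f x \<odot> f y) \<and>
     (\<forall>x\<in>D. n' (f x) = \<sigma> (n x))"

context
  fixes D f assumes D: "X.regular_subalgebra D" and f: "semi_embedding D f"
begin

lemma emb_unit: "f e = e'"
  and emb_add: "x \<in> D \<Longrightarrow> y \<in> D \<Longrightarrow> f (x + y) = f x + f y"
  and emb_scale: "x \<in> D \<Longrightarrow> f (c \<star> x) = \<sigma> c \<ast> f x"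
  and emb_mul: "x \<in> D \<Longrightarrow> y \<in> D \<Longrightarrow> f (x \<cdot> y) = f x \<odot> f y"
  and emb_n: "x \<in> D \<Longrightarrow> n' (f x) = \<sigma> (n x)"
  using f by (simp_all add: semi_embedding_def)

lemma emb_zero: "f 0 = 0"
  using emb_scale[OF X.regular_closed(5)[OF D], of 0] by simp

lemma emb_minus: "x \<in> D \<Longrightarrow> f (- x) = - f x"
  using emb_scale[of x "- 1"] by simp

lemma emb_diff: "x \<in> D \<Longrightarrow> y \<in> D \<Longrightarrow> f (x - y) = f x - f y"
  using emb_add[of x "- y"] X.regular_closed(4)[OF D] by (simp add: emb_minus)

lemma emb_B: "x \<in> D \<Longrightarrow> y \<in> D \<Longrightarrow> Y.B (f x) (f y) = \<sigma> (X.B x y)"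
  using emb_n[of "x + y"] X.regular_closed(1)[OF D]
  by (simp add: emb_add X.n_add Y.n_add sigma_add emb_n)

lemma emb_bar: "x \<in> D \<Longrightarrow> f (X.bar x) = Y.bar (f x)"
  using X.regular_closed(3,6)[OF D] emb_B[of x e]
  by (simp add: X.bar_def Y.bar_def emb_diff emb_scale emb_unit)

text \<open>A vector of the kernel is orthogonal to all of \<open>D\<close>, as
  \<open>\<sigma>\<close> is injective, so regularity makes it 0.\<close>

lemma emb_inj: "inj_on f D"
proof (rule inj_onI)
  fix x y assume xy: "x \<in> D" "y \<in> D" "f x = f y"
  then have mem: "x - y \<in> D" and zero: "f (x - y) = 0"
    using X.regular_closed(2)[OF D] by (simp_all add: emb_diff)
  have "X.B (x - y) z = 0" if "z \<in> D" for z
    using emb_B[OF mem that] zero by (simp add: sigma_eq_0)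
  then have "x - y \<in> X.perp D" by (simp add: X.perp_def)
  then show "x = y" using X.regular_perp_Int[OF D mem] by simp
qed

lemma emb_bar_submonoid: "Y.bar_submonoid (f ` D)"
  unfolding Y.bar_submonoid_def
proof (intro conjI ballI)
  show "e' \<in> f ` D" using emb_unit X.regular_closed(6)[OF D] by blast
  show "x \<odot> y \<in> f ` D" if "x \<in> f ` D" "y \<in> f ` D" for x y
    using that emb_mul X.regular_closed(7)[OF D] by (auto simp: image_iff) metis
  show "Y.bar x \<in> f ` D" if "x \<in> f ` D" for x
    using that emb_bar X.regular_bar[OF D] by (auto simp: image_iff) metis
qed

text \<open>The doubling rules express product and norm of the double through those of
  \<open>D\<close> and the scalar \<open>n b\<close>, so sending \<open>b\<close> to a vector of
  corresponding norm extends \<open>f\<close>. In the target, the rules are applied to the image of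
  \<open>D\<close>, which is known only to be a \<open>bar_submonoid\<close>.\<close>

lemma semi_embedding_double:
  assumes b: "b \<in> X.perp D" "n b \<noteq> 0" and b': "b' \<in> Y.perp (f ` D)" "n' b' = \<sigma> (n b)"
  obtains g where "semi_embedding (X.double D b) g" "\<And>x. x \<in> D \<Longrightarrow> g x = f x" "g b = b'"
proof -
  note closed = X.regular_closed[OF D] X.regular_bar[OF D]
  note sub = X.regular_bar_submonoid[OF D]
  define g where "g x = (THE y. \<exists>p\<in>D. \<exists>q\<in>D. x = p + q \<cdot> b \<and> y = f p + f q \<odot> b')" for x
  have g: "g (p + q \<cdot> b) = f p + f q \<odot> b'" if "p \<in> D" "q \<in> D" for p q
    unfolding g_def
  proof (rule the_equality)
    show "\<exists>r\<in>D. \<exists>s\<in>D. p + q \<cdot> b = r + s \<cdot> b \<and> f p + f q \<odot> b' = f r + f s \<odot> b'"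
      using that by blast
    fix y assume "\<exists>r\<in>D. \<exists>s\<in>D. p + q \<cdot> b = r + s \<cdot> b \<and> y = f r + f s \<odot> b'"
    then show "y = f p + f q \<odot> b'"
      using that X.double_decomposition_unique[OF D b] by metis
  qed
  have gD: "g x = f x" if "x \<in> D" for x
    using g[of x 0] that closed(5) by (simp add: emb_zero)
  have gb: "g b = b'"
    using g[of 0 e] closed(5,6) by (simp add: emb_zero emb_unit)
  have "semi_embedding (X.double D b) g"
    unfolding semi_embedding_def
  proof (intro conjI ballI allI)
    show "g e = e'" using gD closed(6) emb_unit by simp
  next
    fix x y assume "x \<in> X.double D b" "y \<in> X.double D b"
    then obtain p q r s where m: "p \<in> D" "q \<in> D" "r \<in> D" "s \<in> D"
      and x: "x = p + q \<cdot> b" and y: "y = r + s \<cdot> b"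
      unfolding X.double_def by blast
    have "x + y = (p + r) + (q + s) \<cdot> b" by (simp add: x y X.mul_linear algebra_simps)
    then have "g (x + y) = f (p + r) + f (q + s) \<odot> b'" using m by (simp only: g closed)
    then show "g (x + y) = g x + g y"
      using m by (simp add: x y g emb_add Y.mul_linear algebra_simps)
    have "x \<cdot> y = (p \<cdot> r - n b \<star> (X.bar s \<cdot> q)) + (s \<cdot> p + q \<cdot> X.bar r) \<cdot> b"
      unfolding x y using X.double_mul[OF sub b(1)] m by simp
    then have "g (x \<cdot> y) = f (p \<cdot> r - n b \<star> (X.bar s \<cdot> q)) + f (s \<cdot> p + q \<cdot> X.bar r) \<odot> b'"
      using m by (simp only: g closed)
    also have "\<dots> = (f p \<odot> f r - n' b' \<ast> (Y.bar (f s) \<odot> f q)) + (f s \<odot> f p + f q \<odot> Y.bar (f r)) \<odot> b'"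
      using m closed by (simp add: emb_add emb_diff emb_mul emb_scale emb_bar b'(2))
    also have "\<dots> = (f p + f q \<odot> b') \<odot> (f r + f s \<odot> b')"
      using m by (intro Y.double_mul[OF emb_bar_submonoid b'(1), symmetric]) auto
    finally show "g (x \<cdot> y) = g x \<odot> g y" using m by (simp add: x y g)
  next
    fix c x assume "x \<in> X.double D b"
    then obtain p q where m: "p \<in> D" "q \<in> D" and x: "x = p + q \<cdot> b"
      unfolding X.double_def by blast
    have "c \<star> x = c \<star> p + (c \<star> q) \<cdot> b" by (simp add: x X.scale_right_distrib)
    then have "g (c \<star> x) = f (c \<star> p) + f (c \<star> q) \<odot> b'" using m by (simp only: g closed)
    then show "g (c \<star> x) = \<sigma> c \<ast> g x"
      using m by (simp add: x g emb_scale Y.scale_right_distrib)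
  next
    fix x assume "x \<in> X.double D b"
    then obtain p q where m: "p \<in> D" "q \<in> D" and x: "x = p + q \<cdot> b"
      unfolding X.double_def by blast
    have "n' (f p + f q \<odot> b') = n' (f p) + n' (f q) * n' b'"
      using m by (intro Y.n_double[OF emb_bar_submonoid b'(1)]) auto
    then show "n' (g x) = \<sigma> (n x)"
      using m by (simp add: x g X.n_double[OF sub b(1)] emb_n b'(2) sigma_add)
  qed
  then show ?thesis using that gD gb by blast
qed

end

lemma semi_embedding_adjoin:
  assumes w: "X.cube_root w" and w': "Y.cube_root w'"
  obtains f where "semi_embedding (X.adjoin w) f" "f w = w'"
proof -
  note closed = X.regular_closed[OF X.regular_adjoin[OF w]]
  have uniq: "\<alpha> = \<gamma> \<and> \<beta> = \<delta>" if "\<alpha> \<star> e + \<beta> \<star> w = \<gamma> \<star> e + \<delta> \<star> w" for \<alpha> \<beta> \<gamma> \<delta>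
  proof -
    have eq: "(\<beta> - \<delta>) \<star> w = (\<gamma> - \<alpha>) \<star> e" using that by (simp add: algebra_simps)
    have "w \<notin> range (\<lambda>c. c \<star> e)" using X.cube_root_not_scalar[OF w] by blast
    then have "\<beta> - \<delta> = 0" "\<gamma> - \<alpha> = 0" using X.scale_eq_scale_unit eq by blast+
    then show ?thesis by simp
  qed
  define f where "f x = (THE y. \<exists>\<alpha> \<beta>. x = \<alpha> \<star> e + \<beta> \<star> w \<and> y = \<sigma> \<alpha> \<ast> e' + \<sigma> \<beta> \<ast> w')" for x
  have f: "f (\<alpha> \<star> e + \<beta> \<star> w) = \<sigma> \<alpha> \<ast> e' + \<sigma> \<beta> \<ast> w'" for \<alpha> \<beta>
    unfolding f_def
  proof (rule the_equality)
    fix y assume "\<exists>\<gamma> \<delta>. \<alpha> \<star> e + \<beta> \<star> w = \<gamma> \<star> e + \<delta> \<star> w \<and> y = \<sigma> \<gamma> \<ast> e' + \<sigma> \<delta> \<ast> w'"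
    then show "y = \<sigma> \<alpha> \<ast> e' + \<sigma> \<beta> \<ast> w'" using uniq by metis
  qed blast
  have "semi_embedding (X.adjoin w) f"
    unfolding semi_embedding_def
  proof (intro conjI ballI allI)
    show "f e = e'" using f[of 1 0] by simp
  next
    fix x y assume "x \<in> X.adjoin w" "y \<in> X.adjoin w"
    then obtain \<alpha> \<beta> \<gamma> \<delta> where x: "x = \<alpha> \<star> e + \<beta> \<star> w" and y: "y = \<gamma> \<star> e + \<delta> \<star> w"
      unfolding X.adjoin_def by blast
    have fx: "f x = \<sigma> \<alpha> \<ast> e' + \<sigma> \<beta> \<ast> w'" "f y = \<sigma> \<gamma> \<ast> e' + \<sigma> \<delta> \<ast> w'"
      by (simp_all only: x y f)
    have "x + y = (\<alpha> + \<gamma>) \<star> e + (\<beta> + \<delta>) \<star> w" by (simp add: x y algebra_simps)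
    then have "f (x + y) = \<sigma> (\<alpha> + \<gamma>) \<ast> e' + \<sigma> (\<beta> + \<delta>) \<ast> w'" by (simp only: f)
    then show "f (x + y) = f x + f y"
      by (simp add: fx sigma_add algebra_simps)
    have "x \<cdot> y = (\<alpha> * \<gamma> - \<beta> * \<delta>) \<star> e + (\<alpha> * \<delta> + \<beta> * \<gamma> - \<beta> * \<delta>) \<star> w"
      by (simp add: x y X.mul_linear X.cube_root_mul_self[OF w] algebra_simps)
    then have "f (x \<cdot> y) = \<sigma> (\<alpha> * \<gamma> - \<beta> * \<delta>) \<ast> e' + \<sigma> (\<alpha> * \<delta> + \<beta> * \<gamma> - \<beta> * \<delta>) \<ast> w'"
      by (simp only: f)
    then show "f (x \<cdot> y) = f x \<odot> f y"
      by (simp add: fx Y.mul_linear Y.cube_root_mul_self[OF w'] sigma_add sigma_diff algebra_simps)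
  next
    fix c x assume "x \<in> X.adjoin w"
    then obtain \<alpha> \<beta> where x: "x = \<alpha> \<star> e + \<beta> \<star> w" unfolding X.adjoin_def by blast
    have "c \<star> x = (c * \<alpha>) \<star> e + (c * \<beta>) \<star> w" by (simp add: x algebra_simps)
    then have "f (c \<star> x) = \<sigma> (c * \<alpha>) \<ast> e' + \<sigma> (c * \<beta>) \<ast> w'" by (simp only: f)
    then show "f (c \<star> x) = \<sigma> c \<ast> f x" by (simp add: x f algebra_simps)
  next
    fix x assume "x \<in> X.adjoin w"
    then obtain \<alpha> \<beta> where x: "x = \<alpha> \<star> e + \<beta> \<star> w" unfolding X.adjoin_def by blast
    show "n' (f x) = \<sigma> (n x)"
      by (simp add: x f X.n_add Y.n_add X.cube_root_B[OF w] Y.cube_root_B[OF w'] X.cube_root_n[OF w]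
          Y.cube_root_n[OF w'] sigma_add sigma_diff power2_eq_square)
  qed
  moreover have "f w = w'" using f[of 0 1] by simp
  ultimately show ?thesis using that by blast
qed

lemma semi_embedding_frame:
  assumes fr: "X.frame w a b" and fr': "Y.frame w' a' b'"
    and na: "n' a' = \<sigma> (n a)" and nb: "n' b' = \<sigma> (n b)"
  obtains g where "semi_embedding (X.double (X.double (X.adjoin w) a) b) g"
    "g w = w'" "g a = a'" "g b = b'"
proof -
  have w: "X.cube_root w" and a: "a \<in> X.perp (X.adjoin w)" "n a \<noteq> 0"
    and b: "b \<in> X.perp (X.double (X.adjoin w) a)" "n b \<noteq> 0"
    using fr by (auto simp: X.frame_def)
  have w': "Y.cube_root w'" and a': "a' \<in> Y.perp (Y.adjoin w')"
    and b': "b' \<in> Y.perp (Y.double (Y.adjoin w') a')" and na': "n' a' \<noteq> 0"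
    using fr' by (auto simp: Y.frame_def)
  note rD = X.regular_adjoin[OF w]
  note rE = X.regular_double[OF rD a]
  obtain f where f: "semi_embedding (X.adjoin w) f" "f w = w'"
    using semi_embedding_adjoin[OF w w'] .
  \<comment> \<open>\<open>a'\<close> is orthogonal to all of \<open>Y.adjoin w'\<close>; the
    inclusion transfers this to the image of \<open>f\<close>, which may be smaller.\<close>
  have imD: "f ` X.adjoin w \<subseteq> Y.adjoin w'"
  proof
    fix y assume "y \<in> f ` X.adjoin w"
    then obtain \<alpha> \<beta> where "y = f (\<alpha> \<star> e + \<beta> \<star> w)" by (auto simp: X.adjoin_def)
    then have "y = \<sigma> \<alpha> \<ast> e' + \<sigma> \<beta> \<ast> w'"
      using X.regular_closed(3,6)[OF rD] X.self_in_adjoin[OF w]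
      by (simp add: emb_add[OF rD f(1)] emb_scale[OF rD f(1)] emb_unit[OF rD f(1)] f(2))
    then show "y \<in> Y.adjoin w'" by (metis Y.adjoin_eqI)
  qed
  obtain h where h: "semi_embedding (X.double (X.adjoin w) a) h"
      "\<And>x. x \<in> X.adjoin w \<Longrightarrow> h x = f x" "h a = a'"
    using semi_embedding_double[OF rD f(1) a _ na] a' Y.perp_antimono[OF imD] by blast
  have imE: "h ` X.double (X.adjoin w) a \<subseteq> Y.double (Y.adjoin w') a'"
  proof
    fix y assume "y \<in> h ` X.double (X.adjoin w) a"
    then obtain p q where pq: "p \<in> X.adjoin w" "q \<in> X.adjoin w" and y: "y = h (p + q \<cdot> a)"
      by (auto simp: X.double_def)
    have mem: "p \<in> X.double (X.adjoin w) a" "q \<in> X.double (X.adjoin w) a" "a \<in> X.double (X.adjoin w) a"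
      using pq X.subset_double[OF rD a] X.self_in_double[OF rD a] by blast+
    have "y = f p + f q \<odot> a'"
      using mem X.regular_mul[OF rE] pq h by (simp add: y emb_add[OF rE h(1)] emb_mul[OF rE h(1)])
    then show "y \<in> Y.double (Y.adjoin w') a'" using pq imD unfolding Y.double_def by blast
  qed
  obtain g where g: "semi_embedding (X.double (X.double (X.adjoin w) a) b) g"
      "\<And>x. x \<in> X.double (X.adjoin w) a \<Longrightarrow> g x = h x" "g b = b'"
    using semi_embedding_double[OF rE h(1) b _ nb] b' Y.perp_antimono[OF imE] by blast
  have "g w = w'"
    using g(2) h(2) f(2) X.self_in_adjoin[OF w] X.subset_double[OF rD a] by auto
  moreover have "g a = a'" using g(2) h(3) X.self_in_double[OF rD a] by simp
  ultimately show ?thesis using that g by blast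
qed

end

section \<open>Embeddings between eight-dimensional algebras\<close>

locale cayley_pair = hurwitz_pair smul mul n e smul' mul' n' e' \<sigma> +
    X: cayley_space smul mul n e + Y: cayley_space smul' mul' n' e'
  for smul :: "'f::field \<Rightarrow> 'a::ab_group_add \<Rightarrow> 'a" (infixr "\<star>" 75)
    and mul :: "'a \<Rightarrow> 'a \<Rightarrow> 'a" (infixl "\<cdot>" 70) and n :: "'a \<Rightarrow> 'f" and e :: 'a
    and smul' :: "'k::field \<Rightarrow> 'b::ab_group_add \<Rightarrow> 'b" (infixr "\<ast>" 75)
    and mul' :: "'b \<Rightarrow> 'b \<Rightarrow> 'b" (infixl "\<odot>" 70) and n' :: "'b \<Rightarrow> 'k" and e' :: 'b
    and \<sigma> :: "'f \<Rightarrow> 'k"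
begin

lemma frame_embedding:
  assumes fr: "X.frame w a b" and fr': "Y.frame w' a' b'"
    and na: "n' a' = \<sigma> (n a)" and nb: "n' b' = \<sigma> (n b)"
  obtains g where "semi_embedding UNIV g" "g w = w'" "g a = a'" "g b = b'"
  using semi_embedding_frame[OF assms] X.double_frame[OF fr] by metis

context
  fixes g assumes g: "semi_embedding UNIV g"
begin

lemmas emb_UNIV = emb_add[OF X.regular_UNIV g UNIV_I UNIV_I] emb_scale[OF X.regular_UNIV g UNIV_I]
  emb_mul[OF X.regular_UNIV g UNIV_I UNIV_I] emb_unit[OF X.regular_UNIV g]
  emb_n[OF X.regular_UNIV g UNIV_I] emb_bar[OF X.regular_UNIV g UNIV_I]

lemma emb_intertwines:
  assumes fr: "X.frame w a b"
    and t: "composition_automorphism smul mul n \<tau>" "composition_automorphism smul' mul' n' \<tau>'"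
    and gens: "g (\<tau> w) = \<tau>' (g w)" "g (\<tau> a) = \<tau>' (g a)" "g (\<tau> b) = \<tau>' (g b)"
  shows "g (\<tau> x) = \<tau>' (g x)"
proof -
  have 1: "\<tau> (x + y) = \<tau> x + \<tau> y" "\<tau> (c \<star> x) = c \<star> \<tau> x" "\<tau> (x \<cdot> y) = \<tau> x \<cdot> \<tau> y" for c x y
    using t(1) by (simp_all add: composition_automorphism_def composition_isomorphism_def
        algebra_isomorphism_def)
  have 2: "\<tau>' (x + y) = \<tau>' x + \<tau>' y" "\<tau>' (c \<ast> x) = c \<ast> \<tau>' x" "\<tau>' (x \<odot> y) = \<tau>' x \<odot> \<tau>' y" for c x y
    using t(2) by (simp_all add: composition_automorphism_def composition_isomorphism_def
        algebra_isomorphism_def)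
  show ?thesis
    using fr by (induction x rule: X.frame_induct)
      (simp_all add: 1 2 emb_UNIV gens X.automorphism_unit[OF t(1)] Y.automorphism_unit[OF t(2)])
qed

lemma emb_petersson:
  assumes "\<And>x. g (\<tau> x) = \<tau>' (g x)"
  shows "g (petersson smul mul n e \<tau> x y) = petersson smul' mul' n' e' \<tau>' (g x) (g y)"
  by (simp add: petersson_def emb_UNIV assms)

lemma emb_frame_basis: "g ` X.frame_basis w a b = Y.frame_basis (g w) (g a) (g b)"
  by (simp add: X.frame_basis_def Y.frame_basis_def image_Un image_image emb_UNIV)

text \<open>The basis carried to a basis is \<open>frame_basis\<close>. The products are left
  arbitrary so that Petersson products can be inserted.\<close>

lemma emb_scalar_extension:
  assumes fr: "X.frame w a b" and fr': "Y.frame (g w) (g a) (g b)"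
    and mul: "\<And>x y. g (pmul x y) = pmul' (g x) (g y)"
  shows "scalar_extension \<sigma> smul UNIV pmul smul' UNIV pmul' g"
proof -
  let ?S = "X.frame_basis w a b"
  have "X.basis_of ?S UNIV"
    using X.frame_basis_independent[OF fr] X.double_frame[OF fr] by (simp add: X.basis_of_def)
  moreover have "Y.basis_of (g ` ?S) UNIV"
    using Y.frame_basis_independent[OF fr'] Y.double_frame[OF fr']
    by (simp add: Y.basis_of_def emb_frame_basis)
  moreover have "inj_on g ?S"
    using emb_inj[OF X.regular_UNIV g] inj_on_subset by blast
  ultimately show ?thesis
    unfolding scalar_extension_def using mul by (auto simp: emb_UNIV sigma_add)
qed

text \<open>The range is closed under sums and products, contains the target frame and,
  \<open>\<sigma>\<close> being onto, the needed scalar multiples; so \<open>frame_induct\<close>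
  makes it everything.\<close>

lemma emb_bij:
  assumes "surj \<sigma>" and fr': "Y.frame (g w) (g a) (g b)"
  shows "bij g"
proof -
  have "y \<in> range g" for y
    using fr'
  proof (induction y rule: Y.frame_induct)
    case (unit c)
    then show ?case using \<open>surj \<sigma>\<close> by (metis emb_UNIV(2,4) rangeI surjD)
  next
    case (cube_root c)
    then show ?case using \<open>surj \<sigma>\<close> by (metis emb_UNIV(2) rangeI surjD)
  qed (use emb_UNIV(1,3) in \<open>auto simp: image_iff\<close>, (metis emb_UNIV(1,3))+)
  then show ?thesis
    using emb_inj[OF X.regular_UNIV g] by (auto simp: bij_def)
qed

end

end

section \<open>The split Cayley algebra\<close>

lemma numeral_3_arith: "(3 :: 3) = 0" "(4 :: 3) = 1" "(1 :: 3) + 2 = 0" "(2 :: 3) + 1 = 0" "(2 :: 3) + 2 = 1"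
  by simp_all

lemma UNIV_3_zero: "(UNIV :: 3 set) = {0, 1, 2}"
proof -
  have "(3 :: 3) = 0" by simp
  then show ?thesis unfolding UNIV_3 by (simp only: insert_commute)
qed

lemma sum_3_zero: "sum f (UNIV :: 3 set) = f 0 + f 1 + f 2"
  unfolding UNIV_3_zero by (simp add: add.assoc)

lemma forall_3_zero: "(\<forall>i::3. P i) \<longleftrightarrow> P 0 \<and> P 1 \<and> P 2"
  unfolding ball_UNIV[symmetric] UNIV_3_zero by simp

lemma UNIV_zorn: "(UNIV :: zorn_index set) = {E1, E2, U 0, U 1, U 2, V 0, V 1, V 2}"
proof -
  have "p \<in> {E1, E2, U 0, U 1, U 2, V 0, V 1, V 2}" for p
    using UNIV_3_zero by (cases p) auto
  then show ?thesis by blast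
qed

lemma sum_zorn: "sum f (UNIV :: zorn_index set) =
    f E1 + f E2 + (f (U 0) + f (U 1) + f (U 2)) + (f (V 0) + f (V 1) + f (V 2))"
  by (simp add: UNIV_zorn add.assoc)

lemma vec_zorn_eq_iff: "x = y \<longleftrightarrow> x $ E1 = y $ E1 \<and> x $ E2 = y $ E2 \<and>
    (\<forall>i. x $ U i = y $ U i) \<and> (\<forall>i. x $ V i = y $ V i)"
proof -
  have "(\<forall>p. P p) \<longleftrightarrow> P E1 \<and> P E2 \<and> (\<forall>i. P (U i)) \<and> (\<forall>i. P (V i))" for P
    by (metis zorn_index.exhaust)
  then show ?thesis by (simp add: vec_eq_iff)
qed

text \<open>Zorn's vector matrix product: the last terms of the \<open>U\<close> and
  \<open>V\<close> coordinates are components of cross products.\<close>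

lemma zorn_mult_nth:
  "zorn_mult x y $ E1 = x $ E1 * y $ E1 - (\<Sum>i\<in>UNIV. x $ U i * y $ V i)"
  "zorn_mult x y $ E2 = x $ E2 * y $ E2 - (\<Sum>i\<in>UNIV. x $ V i * y $ U i)"
  "zorn_mult x y $ U i = x $ E1 * y $ U i + x $ U i * y $ E2 +
     (x $ V (i + 1) * y $ V (i + 2) - x $ V (i + 2) * y $ V (i + 1))"
  "zorn_mult x y $ V i = x $ E2 * y $ V i + x $ V i * y $ E1 +
     (x $ U (i + 1) * y $ U (i + 2) - x $ U (i + 2) * y $ U (i + 1))"
proof -
  have dist: "(0::3) \<noteq> 1" "(1::3) \<noteq> 0" "(0::3) \<noteq> 2" "(2::3) \<noteq> 0" "(1::3) \<noteq> 2" "(2::3) \<noteq> 1"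
    by simp_all
  show "zorn_mult x y $ E1 = x $ E1 * y $ E1 - (\<Sum>i\<in>UNIV. x $ U i * y $ V i)"
    "zorn_mult x y $ E2 = x $ E2 * y $ E2 - (\<Sum>i\<in>UNIV. x $ V i * y $ U i)"
    by (simp_all add: zorn_mult_def sum_zorn sum_3_zero axis_def dist)
  have "\<forall>i. zorn_mult x y $ U i = x $ E1 * y $ U i + x $ U i * y $ E2 +
     (x $ V (i + 1) * y $ V (i + 2) - x $ V (i + 2) * y $ V (i + 1))"
    by (simp add: forall_3_zero zorn_mult_def sum_zorn axis_def dist numeral_3_arith)
  then show "zorn_mult x y $ U i = x $ E1 * y $ U i + x $ U i * y $ E2 +
     (x $ V (i + 1) * y $ V (i + 2) - x $ V (i + 2) * y $ V (i + 1))" ..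
  have "\<forall>i. zorn_mult x y $ V i = x $ E2 * y $ V i + x $ V i * y $ E1 +
     (x $ U (i + 1) * y $ U (i + 2) - x $ U (i + 2) * y $ U (i + 1))"
    by (simp add: forall_3_zero zorn_mult_def sum_zorn axis_def dist numeral_3_arith)
  then show "zorn_mult x y $ V i = x $ E2 * y $ V i + x $ V i * y $ E1 +
     (x $ U (i + 1) * y $ U (i + 2) - x $ U (i + 2) * y $ U (i + 1))" ..
qed

lemma zorn_unit_nth: "zorn_unit $ E1 = 1" "zorn_unit $ E2 = 1" "zorn_unit $ U i = 0" "zorn_unit $ V i = 0"
  by (simp_all add: zorn_unit_def axis_def)

text \<open>\<open>tau_st\<close> moves basis vectors one index forward, so coordinates are read one
  index back, and \<open>i + 2\<close> is \<open>i - 1\<close> modulo 3.\<close>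

lemma tau_st_nth: "tau_st x $ E1 = x $ E1" "tau_st x $ E2 = x $ E2"
  "tau_st x $ U i = x $ U (i + 2)" "tau_st x $ V i = x $ V (i + 2)"
proof -
  show "tau_st x $ E1 = x $ E1" "tau_st x $ E2 = x $ E2"
    by (simp_all add: tau_st_def sum_zorn axis_def)
  have "\<forall>i. tau_st x $ U i = x $ U (i + 2)" "\<forall>i. tau_st x $ V i = x $ V (i + 2)"
    by (simp_all add: forall_3_zero tau_st_def sum_zorn axis_def numeral_3_arith)
  then show "tau_st x $ U i = x $ U (i + 2)" "tau_st x $ V i = x $ V (i + 2)" by blast+
qed

lemma polar_zorn: "polar zorn_norm x y =
    x $ E1 * y $ E2 + x $ E2 * y $ E1 + (\<Sum>i\<in>UNIV. x $ U i * y $ V i + x $ V i * y $ U i)"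
  by (simp add: polar_def zorn_norm_def sum_3_zero algebra_simps)

lemma CARD_zorn_index: "CARD(zorn_index) = 8"
  by (simp add: UNIV_zorn)

lemma zorn_norm_mult: "zorn_norm (zorn_mult x y) = zorn_norm x * zorn_norm y"
  unfolding zorn_norm_def zorn_mult_nth sum_3_zero
  by (simp add: numeral_3_arith algebra_simps)

lemma zorn_nondegenerate:
  assumes "\<And>y. polar zorn_norm x y = 0" shows "x = 0"
proof -
  have "x $ E2 = 0" "x $ E1 = 0" "x $ V i = 0" "x $ U i = 0" for i
    using assms[of "axis E1 1"] assms[of "axis E2 1"] assms[of "axis (U i) 1"] assms[of "axis (V i) 1"]
    by (simp_all add: polar_zorn axis_def if_distrib[of "\<lambda>c. _ * c"] sum.delta' cong: if_cong)
  then show ?thesis by (simp add: vec_zorn_eq_iff)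
qed

lemma cayley_algebra_zorn: "cayley_algebra (*s) UNIV zorn_mult zorn_norm (zorn_unit :: 'k::field ^ zorn_index)"
proof
  have "x = 0" if "x \<in> polar_radical UNIV zorn_norm" for x :: "'k ^ zorn_index"
    using that zorn_nondegenerate by (auto simp: polar_radical_def)
  moreover have "(0 :: 'k ^ zorn_index) \<in> polar_radical UNIV zorn_norm"
    by (simp add: polar_radical_def polar_zorn)
  ultimately have "polar_radical UNIV (zorn_norm :: 'k ^ zorn_index \<Rightarrow> 'k) = {0}" by blast
  then show "polar_radical UNIV (zorn_norm :: 'k ^ zorn_index \<Rightarrow> 'k) = {0} \<or>
      vec.dim (polar_radical UNIV (zorn_norm :: 'k ^ zorn_index \<Rightarrow> 'k)) = 1 \<and>
      (\<forall>x\<in>polar_radical UNIV (zorn_norm :: 'k ^ zorn_index \<Rightarrow> 'k). x \<noteq> 0 \<longrightarrow> zorn_norm x \<noteq> 0)"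
    by simp
  show "vec.dim (UNIV :: ('k ^ zorn_index) set) = 8"
    by (simp add: card_cart_basis CARD_zorn_index)
  fix x y z :: "'k ^ zorn_index" and c :: 'k
  show "zorn_mult (x + y) z = zorn_mult x z + zorn_mult y z"
    by (simp add: vec_zorn_eq_iff zorn_mult_nth sum_3_zero numeral_3_arith algebra_simps)
  show "zorn_mult x (y + z) = zorn_mult x y + zorn_mult x z"
    by (simp add: vec_zorn_eq_iff zorn_mult_nth sum_3_zero numeral_3_arith algebra_simps)
  show "zorn_mult (c *s x) y = c *s zorn_mult x y" "zorn_mult x (c *s y) = c *s zorn_mult x y"
    by (simp_all add: vec_zorn_eq_iff zorn_mult_nth sum_3_zero numeral_3_arith algebra_simps)
  show "zorn_norm (c *s x) = c\<^sup>2 * zorn_norm x"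
    by (simp add: zorn_norm_def sum_3_zero power2_eq_square algebra_simps)
  show "polar zorn_norm (x + y) z = polar zorn_norm x z + polar zorn_norm y z"
    "polar zorn_norm (c *s x) y = c * polar zorn_norm x y"
    by (simp_all add: polar_zorn sum_3_zero algebra_simps)
  show "zorn_norm (zorn_mult x y) = zorn_norm x * zorn_norm y"
    by (rule zorn_norm_mult)
  show "zorn_mult zorn_unit x = x" "zorn_mult x zorn_unit = x"
    by (simp_all add: vec_zorn_eq_iff zorn_mult_nth zorn_unit_nth)
qed simp_all

lemma composition_automorphism_tau_st:
  "composition_automorphism (*s) zorn_mult zorn_norm (tau_st :: 'k::field ^ zorn_index \<Rightarrow> _)"
proof -
  have "tau_st (tau_st (tau_st x)) = x" for x :: "'k ^ zorn_index"
    by (simp add: vec_zorn_eq_iff forall_3_zero tau_st_nth numeral_3_arith)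
  then have "bij (tau_st :: 'k ^ zorn_index \<Rightarrow> _)"
    by (intro o_bij[of "tau_st \<circ> tau_st"]) (simp_all add: fun_eq_iff)
  moreover have "tau_st (x + y) = tau_st x + tau_st y" "tau_st (c *s x) = c *s tau_st x"
    for x y :: "'k ^ zorn_index" and c
    by (simp_all add: vec_zorn_eq_iff tau_st_nth)
  moreover have "zorn_norm (tau_st x) = zorn_norm x" for x :: "'k ^ zorn_index"
    by (simp add: zorn_norm_def tau_st_nth sum_3_zero numeral_3_arith add_ac)
  moreover have "tau_st (zorn_mult x y) = zorn_mult (tau_st x) (tau_st y)" for x y :: "'k ^ zorn_index"
    by (simp add: vec_zorn_eq_iff forall_3_zero tau_st_nth zorn_mult_nth sum_3_zero numeral_3_arith add_ac)
  ultimately show ?thesis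
    by (simp add: composition_automorphism_def composition_isomorphism_def algebra_isomorphism_def)
qed

section \<open>Conjugacy\<close>

text \<open>A radical line spanned by \<open>r\<close> is stable under left multiplication, so each
  \<open>x\<close> acts on \<open>r\<close> by a scalar \<open>c\<close>. Then
  \<open>y = x - c \<star> e\<close> kills the anisotropic \<open>r\<close>, hence is isotropic and
  itself radical, so \<open>y = 0\<close>. Every element would be scalar.\<close>

lemma (in unital_composition) polar_radical_trivial:
  assumes dim: "dim (UNIV :: 'a set) = 8" shows "polar_radical UNIV n = {0}"
proof (rule ccontr)
  let ?R = "polar_radical UNIV n"
  assume "?R \<noteq> {0}"
  then have dimR: "dim ?R = 1" and aniso: "\<And>x. x \<in> ?R \<Longrightarrow> x \<noteq> 0 \<Longrightarrow> n x \<noteq> 0"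
    using nonsingular by auto
  obtain S where S: "S \<subseteq> ?R" "independent S" "?R \<subseteq> span S" "card S = 1"
    using basis_exists[of ?R] dimR by metis
  then obtain r where "S = {r}" using card_1_singletonE by blast
  then have r: "r \<in> ?R" "r \<noteq> 0" and spanR: "?R \<subseteq> span {r}"
    using S dependent_zero by auto
  have "x \<in> span {e}" for x
  proof -
    have "x \<cdot> r \<in> ?R"
      using r(1) by (simp add: polar_radical_def B_adjoint_left)
    then obtain c where "x \<cdot> r = c \<star> r" using spanR by (auto simp: span_singleton)
    then have zero: "(x - c \<star> e) \<cdot> r = 0" by (simp add: mul_linear)
    define y where "y = x - c \<star> e"
    have nr: "n r \<noteq> 0" using aniso r by blast
    have "n y * n r = 0" using zero n_mul[of y r] by (simp add: y_def)
    then have "n y = 0" using nr by simp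
    moreover have "B y z = 0" for z
      using B_mul_right[of y r z] zero nr by (simp add: y_def)
    then have "y \<in> ?R" by (simp add: polar_radical_def)
    ultimately have "y = 0" using aniso by blast
    then show ?thesis by (auto simp: y_def span_singleton)
  qed
  then have "dim (UNIV :: 'a set) \<le> card {e}" by (intro dim_le_card) auto
  then show False using dim by simp
qed

lemma cayley_space_of_cayley_algebra:
  fixes smul :: "'f::field \<Rightarrow> 'a::ab_group_add \<Rightarrow> 'a"
  assumes "cayley_algebra smul UNIV mul n e" and three: "(3 :: 'f) \<noteq> 0"
  shows "cayley_space smul mul n e"
proof -
  interpret C: cayley_algebra smul UNIV mul n e by fact
  interpret unital_composition smul mul n e by unfold_locales
  show ?thesis
  proof
    show "x = 0" if "\<And>y. polar n x y = 0" for x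
      using that polar_radical_trivial[OF C.dim_carrier] by (auto simp: polar_radical_def)
    show "e \<noteq> 0"
    proof
      assume "e = 0"
      then have "x = 0" for x :: 'a using unit_left[of x] by simp
      then have "C.dim UNIV \<le> card ({} :: 'a set)" by (intro C.dim_le_card) auto
      then show False using C.dim_carrier by simp
    qed
  qed (use three C.dim_carrier in simp_all)
qed

context cayley_space
begin

lemma dim_perp:
  assumes D: "regular_subalgebra D" shows "dim D + dim (perp D) = 8"
proof -
  obtain S where "finite_dimensional_vector_space smul S" by (rule finite_dimensional)
  then interpret F: finite_dimensional_vector_space smul S .
  have "x \<in> {x + y |x y. x \<in> D \<and> y \<in> perp D}" for x
  proof -
    obtain d where "d \<in> D" "x - d \<in> perp D" by (rule regular_decompose[OF D])
    then show ?thesis by (intro CollectI exI[of _ d] exI[of _ "x - d"]) simp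
  qed
  then have "{x + y |x y. x \<in> D \<and> y \<in> perp D} = UNIV" by blast
  moreover have "D \<inter> perp D = {0}"
    using regular_perp_Int[OF D] regular_closed(5)[OF D] subspace_0[OF subspace_perp] by blast
  ultimately show ?thesis
    using F.dim_sums_Int[OF regular_subspace[OF D] subspace_perp[of D]] dim_eight by simp
qed

text \<open>
  This replaces Witt cancellation. The two complements share a nonzero vector \<open>r\<close>, as both lie in
  the hyperplane orthogonal to \<open>e\<close>; if \<open>r\<close> is isotropic, then both complements represent \<open>1\<close>.
\<close>

lemma perp_common_norm:
  assumes D: "regular_subalgebra D" "dim D \<le> 4" and E: "regular_subalgebra E" "dim E \<le> 4"
  obtains a b where "a \<in> perp D" "b \<in> perp E" "n a = n b" "n a \<noteq> 0"
proof -
  obtain S where "finite_dimensional_vector_space smul S" by (rule finite_dimensional)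
  then interpret F: finite_dimensional_vector_space smul S .
  let ?T = "{x + y |x y. x \<in> perp D \<and> y \<in> perp E}"
  have T: "subspace ?T" by (intro subspace_sums subspace_perp)
  have "?T \<noteq> UNIV"
  proof
    assume "?T = UNIV"
    have "B e z = 0" for z
    proof -
      obtain x y where "z = x + y" "x \<in> perp D" "y \<in> perp E" using \<open>?T = UNIV\<close> by blast
      then show ?thesis using perpD(2) regular_unit D E by (simp add: B_linear)
    qed
    then show False using B_nondegenerate unit_nonzero by blast
  qed
  then have "span ?T \<noteq> UNIV" using span_minimal[OF subset_refl T] by auto
  then have "dim ?T \<noteq> 8"
    using F.dim_eq_full[of ?T] F.dim_UNIV dim_eight by (simp add: F.dimension_def)
  moreover have "dim ?T \<le> 8" using F.dim_subset_UNIV[of ?T] F.dim_UNIV dim_eight by (simp add: F.dimension_def)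
  \<comment> \<open>Each complement has dimension at least 4, and their sum has dimension at most
    7.\<close>
  ultimately have "dim (perp D \<inter> perp E) \<noteq> 0"
    using F.dim_sums_Int[OF subspace_perp[of D] subspace_perp[of E]] dim_perp[OF D(1)] dim_perp[OF E(1)]
      D(2) E(2) by linarith
  then have "\<not> perp D \<inter> perp E \<subseteq> {0}" using F.dim_eq_0[of "perp D \<inter> perp E"] by metis
  then obtain r where r: "r \<in> perp D" "r \<in> perp E" "r \<noteq> 0" by blast
  show ?thesis
  proof (cases "n r = 0")
    case False
    then show ?thesis using r that by blast
  next
    case True
    have unit: "\<exists>a\<in>perp G. n a = 1" if G: "regular_subalgebra G" and rG: "r \<in> perp G" for G
    proof -
      obtain y where y: "y \<in> perp G" "B r y \<noteq> 0"
        by (rule regular_perp_nondegenerate[OF G rG r(3)])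
      \<comment> \<open>As \<open>r\<close> is isotropic, the norm of \<open>c \<star> r + y\<close>
        is affine in \<open>c\<close>; this value makes it 1.\<close>
      define c where "c = (1 - n y) / B r y"
      have "n (c \<star> r + y) = 1" using y True by (simp add: n_add c_def)
      moreover have "c \<star> r + y \<in> perp G"
        using y rG subspace_add[OF subspace_perp] subspace_scale[OF subspace_perp] by blast
      ultimately show ?thesis by blast
    qed
    show ?thesis using unit[OF D(1) r(1)] unit[OF E(1) r(2)] that by fastforce
  qed
qed

lemma frame_automorphism:
  assumes "frame w a b" "frame w' a' b'" "n a = n a'" "n b = n b'"
  obtains \<phi> where "composition_automorphism smul mul n \<phi>" "\<phi> w = w'" "\<phi> a = a'" "\<phi> b = b'"
    "\<And>\<tau> \<tau>'. composition_automorphism smul mul n \<tau> \<Longrightarrow> composition_automorphism smul mul n \<tau>' \<Longrightarrow>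
      \<phi> (\<tau> w) = \<tau>' w' \<Longrightarrow> \<phi> (\<tau> a) = \<tau>' a' \<Longrightarrow> \<phi> (\<tau> b) = \<tau>' b' \<Longrightarrow> \<tau>' \<circ> \<phi> = \<phi> \<circ> \<tau>"
proof -
  interpret P: cayley_pair smul mul n e smul mul n e "\<lambda>c. c" by unfold_locales auto
  obtain \<phi> where \<phi>: "P.semi_embedding UNIV \<phi>" "\<phi> w = w'" "\<phi> a = a'" "\<phi> b = b'"
    using P.frame_embedding[OF assms(1,2)] assms(3,4) by metis
  have "bij \<phi>" using P.emb_bij[OF \<phi>(1), of w a b] assms(2) \<phi>(2-4) by (simp add: surj_def)
  then have "composition_automorphism smul mul n \<phi>"
    using P.emb_UNIV[OF \<phi>(1)]
    by (simp add: composition_automorphism_def composition_isomorphism_def algebra_isomorphism_def)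
  moreover have "\<tau>' \<circ> \<phi> = \<phi> \<circ> \<tau>"
    if "composition_automorphism smul mul n \<tau>" "composition_automorphism smul mul n \<tau>'"
      "\<phi> (\<tau> w) = \<tau>' w'" "\<phi> (\<tau> a) = \<tau>' a'" "\<phi> (\<tau> b) = \<tau>' b'" for \<tau> \<tau>'
    using P.emb_intertwines[OF \<phi>(1) assms(1) that(1,2)] that(3-5) \<phi>(2-4) by (simp add: fun_eq_iff)
  ultimately show ?thesis using that \<phi>(2-4) by blast
qed

text \<open>An automorphism taking \<open>w\<^sub>1\<close> to \<open>w\<^sub>2\<close> conjugates
  one map to the other. It comes from frames with equal norms, found by applying
  \<open>perp_common_norm\<close> to the two-dimensional subalgebras and then to their
  doubles.\<close>

lemma conjugate_conjugation:
  assumes \<tau>1: "conjugation_by_cube_root smul mul e \<tau>\<^sub>1 w\<^sub>1"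
    and \<tau>2: "conjugation_by_cube_root smul mul e \<tau>\<^sub>2 w\<^sub>2"
  shows "conjugate_automorphisms smul mul n \<tau>\<^sub>1 \<tau>\<^sub>2"
proof -
  have w: "cube_root w\<^sub>1" "cube_root w\<^sub>2"
    using \<tau>1 \<tau>2 by (simp_all add: conjugation_by_cube_root_def primitive_cube_root_iff)
  obtain a\<^sub>1 a\<^sub>2 where a: "a\<^sub>1 \<in> perp (adjoin w\<^sub>1)" "a\<^sub>2 \<in> perp (adjoin w\<^sub>2)" "n a\<^sub>1 = n a\<^sub>2" "n a\<^sub>1 \<noteq> 0"
    using perp_common_norm[OF regular_adjoin[OF w(1)] _ regular_adjoin[OF w(2)]] dim_adjoin w by auto
  then have na2: "n a\<^sub>2 \<noteq> 0" by simp
  obtain b\<^sub>1 b\<^sub>2 where b: "b\<^sub>1 \<in> perp (double (adjoin w\<^sub>1) a\<^sub>1)" "b\<^sub>2 \<in> perp (double (adjoin w\<^sub>2) a\<^sub>2)"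
      "n b\<^sub>1 = n b\<^sub>2" "n b\<^sub>1 \<noteq> 0"
    using perp_common_norm[OF regular_double[OF regular_adjoin[OF w(1)] a(1,4)] _
        regular_double[OF regular_adjoin[OF w(2)] a(2) na2]]
      dim_double_adjoin[OF w(1) a(1,4)] dim_double_adjoin[OF w(2) a(2) na2] by auto
  have "frame w\<^sub>1 a\<^sub>1 b\<^sub>1" "frame w\<^sub>2 a\<^sub>2 b\<^sub>2" using w a b by (auto simp: frame_def)
  then obtain \<phi> where \<phi>: "composition_automorphism smul mul n \<phi>" "\<phi> w\<^sub>1 = w\<^sub>2"
    using frame_automorphism a(3) b(3) by metis
  have "\<phi> (mul x y) = mul (\<phi> x) (\<phi> y)" for x y
    using \<phi>(1) by (simp add: composition_automorphism_def composition_isomorphism_def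
        algebra_isomorphism_def)
  then have "\<tau>\<^sub>2 \<circ> \<phi> = \<phi> \<circ> \<tau>\<^sub>1"
    using \<tau>1 \<tau>2 \<phi>(2) by (simp add: conjugation_by_cube_root_def fun_eq_iff)
  then show ?thesis using \<phi>(1) by (auto simp: conjugate_automorphisms_def)
qed

text \<open>
  The vector \<open>c\<close> is \<open>p a p\<^sup>-\<^sup>1\<close>, where \<open>p\<close> conjugates \<open>v\<close> or \<open>bar v\<close> to \<open>u\<close>. Either \<open>p = u - bar v\<close> or
  \<open>p = u - v\<close> works: if the first is isotropic, then the second has norm \<open>3\<close>.
\<close>

lemma perp_adjoin_transport:
  assumes D: "regular_subalgebra D" and u: "cube_root u" "u \<in> D" and v: "cube_root v" "v \<in> D"
    and a: "a \<in> D" "a \<in> perp (adjoin v)"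
  obtains c where "c \<in> D" "c \<in> perp (adjoin u)" "n c = n a"
proof -
  have Ba: "B a e = 0" "B a v = 0" using a(2) in_perp_adjoin_iff[OF v(1)] by auto
  note result = that
  have main: thesis if p: "p \<in> D" "n p \<noteq> 0" and up: "u \<cdot> p = p \<cdot> v \<or> u \<cdot> p = p \<cdot> bar v" for p
  proof -
    define c where "c = inverse (n p) \<star> ((p \<cdot> a) \<cdot> bar p)"
    have "c \<in> D" using p a regular_closed[OF D] regular_bar[OF D] by (simp add: c_def)
    moreover have "B c e = 0"
      using Ba B_mul_left[of p a e] by (simp add: c_def B_adjoint_right[of "p \<cdot> a"])
    moreover have "B a (bar v) = 0" using Ba by (simp add: cube_root_bar[OF v(1)] B_linear)
    \<comment> \<open>By adjunction this is, up to a scalar,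
      \<open>B (p \<cdot> a) (u \<cdot> p)\<close>; rewriting \<open>u \<cdot> p\<close> turns it
      into \<open>n p\<close> times \<open>B a v\<close> or \<open>B a (bar v)\<close>.\<close>
    then have "B c u = 0"
      using Ba up by (auto simp: c_def B_adjoint_right[of "p \<cdot> a"] B_mul_left)
    moreover have "n c = n a" using p by (simp add: c_def power2_eq_square field_simps)
    ultimately show thesis using result in_perp_adjoin_iff[OF u(1)] by blast
  qed
  show thesis
  proof (cases "n (u - bar v) = 0")
    case False
    have "u \<cdot> (u - bar v) = (u - bar v) \<cdot> v"
      by (simp add: mul_linear cube_root_mul_self[OF u(1)] cube_root_bar[OF v(1)]
          cube_root_mul_self[OF v(1)])
    then show thesis using main[of "u - bar v"] False u v regular_closed(2)[OF D] regular_bar[OF D]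
      by blast
  next
    case True
    have "1 + B u v = 0"
      using True by (simp add: n_diff cube_root_bar[OF v(1)] B_linear n_add cube_root_B[OF u(1)]
          cube_root_B[OF v(1)] u(1) v(1))
    then have "B u v = - 1" by (simp add: eq_neg_iff_add_eq_0 add.commute)
    then have "n (u - v) = 3" by (simp add: n_diff u v)
    moreover have "u \<cdot> (u - v) = (u - v) \<cdot> bar v"
      by (simp add: mul_linear cube_root_mul_self[OF u(1)] cube_root_bar[OF v(1)]
          cube_root_mul_self[OF v(1)])
    ultimately show thesis using main[of "u - v"] three_nonzero u v regular_closed(2)[OF D] by auto
  qed
qed

end

section \<open>Frames adapted to an automorphism with quaternion fixed subalgebra\<close>

context cayley_order_three
begin

text \<open>The root \<open>u\<close> is read off from \<open>b\<close>, and only then is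
  \<open>a\<close> chosen in \<open>Fix \<tau>\<close>. The double of \<open>adjoin u\<close> by
  \<open>a\<close> stays in \<open>Fix \<tau>\<close>, so \<open>b\<close> is orthogonal to it. On
  such a frame the action of \<open>\<tau>\<close> is completely prescribed.\<close>

lemma quaternion_type_frame:
  assumes dim: "dim (Fix \<tau>) = 4" and b: "b \<in> perp (Fix \<tau>)" "n b \<noteq> 0"
  obtains u a where "frame u a b" "u \<in> Fix \<tau>" "a \<in> Fix \<tau>" "\<tau> b = u \<cdot> b"
proof -
  obtain u where u: "u \<in> Fix \<tau>" "cube_root u" "\<tau> b = u \<cdot> b"
    using cube_root_of_perp_Fix[OF b] .
  have "adjoin u \<noteq> Fix \<tau>" using dim dim_adjoin[OF u(2)] by auto
  then obtain a where a: "a \<in> Fix \<tau>" "a \<in> perp (adjoin u)" "n a \<noteq> 0"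
    using anisotropic_in_perp[OF regular_adjoin[OF u(2)] regular_Fix
        adjoin_subset[OF u(2) regular_Fix u(1)]] by metis
  have "double (adjoin u) a \<subseteq> Fix \<tau>"
    using adjoin_subset[OF u(2) regular_Fix u(1)] a(1)
    by (auto simp: double_def intro!: regular_closed(1,7)[OF regular_Fix])
  then have "frame u a b" using u a b perp_antimono by (auto simp: frame_def)
  then show ?thesis using that u a by blast
qed

lemma tau_automorphism: "composition_automorphism smul mul n \<tau>"
  using order_three by (simp add: order_three_automorphism_def)

end

context hurwitz_char_not_3
begin

text \<open>The norm of a nonscalar element is the constant term of its quadratic equation, and that
  of a scalar is its square. So an isomorphism of bare algebras is already an isometry.\<close>

lemma algebra_isomorphism_unit_norm:
  assumes D: "regular_subalgebra D" and E: "regular_subalgebra E"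
    and f: "algebra_isomorphism smul D mul smul E mul f"
  shows "f e = e" and "x \<in> D \<Longrightarrow> n (f x) = n x"
    and "x \<in> D \<Longrightarrow> y \<in> D \<Longrightarrow> B (f x) (f y) = B x y"
proof -
  have bij: "bij_betw f D E" and add: "\<And>x y. x \<in> D \<Longrightarrow> y \<in> D \<Longrightarrow> f (x + y) = f x + f y"
    and scale: "\<And>c x. x \<in> D \<Longrightarrow> f (c \<star> x) = c \<star> f x"
    and mul: "\<And>x y. x \<in> D \<Longrightarrow> y \<in> D \<Longrightarrow> f (x \<cdot> y) = f x \<cdot> f y"
    using f by (auto simp: algebra_isomorphism_def)
  note closed = regular_closed[OF D]
  obtain x\<^sub>0 where x0: "x\<^sub>0 \<in> D" "f x\<^sub>0 = e"
    using bij closed(6) regular_closed(6)[OF E] unfolding bij_betw_def by (metis imageE)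
  have "f e \<cdot> f x\<^sub>0 = f x\<^sub>0" using mul[OF closed(6) x0(1)] by simp
  then show unit: "f e = e" by (simp add: x0)
  have norm: "n (f x) = n x" if x: "x \<in> D" for x
  proof (cases "f x \<in> range (\<lambda>c. c \<star> e)")
    case True
    then obtain c where c: "f x = c \<star> e" by blast
    then have "f x = f (c \<star> e)" by (simp add: scale closed unit)
    then have "x = c \<star> e"
      using bij x closed(3,6) unfolding bij_betw_def by (metis inj_onD)
    then show ?thesis using c by simp
  next
    case False
    have "f (x \<cdot> x) = f (B x e \<star> x + (- n x) \<star> e)" by (simp add: mul_self)
    also have "\<dots> = B x e \<star> f x - n x \<star> e" using x closed by (simp add: add scale unit del: scale_minus_left)
        (simp add: unit)
    finally have "f x \<cdot> f x = B x e \<star> f x - n x \<star> e" by (simp add: mul x)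
    then have "(B (f x) e - B x e) \<star> f x = (n (f x) - n x) \<star> e"
      by (simp add: mul_self algebra_simps)
    then show ?thesis using scale_eq_scale_unit(2)[OF False] by fastforce
  qed
  show "n (f x) = n x" if "x \<in> D" using norm that .
  show "B (f x) (f y) = B x y" if "x \<in> D" "y \<in> D"
    using that closed norm by (simp add: polar_def flip: add)
qed

end

lemma algebra_isomorphism_Fix:
  assumes \<phi>: "composition_automorphism smul mul n \<phi>" and conj: "\<tau>\<^sub>2 \<circ> \<phi> = \<phi> \<circ> \<tau>\<^sub>1"
  shows "algebra_isomorphism smul (Fix \<tau>\<^sub>1) mul smul (Fix \<tau>\<^sub>2) mul \<phi>"
proof -
  have bij: "bij \<phi>" using \<phi>
    by (simp add: composition_automorphism_def composition_isomorphism_def algebra_isomorphism_def)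
  have conj': "\<tau>\<^sub>2 (\<phi> x) = \<phi> (\<tau>\<^sub>1 x)" for x using conj by (metis comp_apply)
  have "\<phi> ` Fix \<tau>\<^sub>1 = Fix \<tau>\<^sub>2"
  proof
    show "\<phi> ` Fix \<tau>\<^sub>1 \<subseteq> Fix \<tau>\<^sub>2" by (auto simp: Fix_def conj')
    show "Fix \<tau>\<^sub>2 \<subseteq> \<phi> ` Fix \<tau>\<^sub>1"
    proof
      fix y assume y: "y \<in> Fix \<tau>\<^sub>2"
      obtain x where x: "y = \<phi> x" using bij by (metis bij_pointE)
      then have "\<phi> (\<tau>\<^sub>1 x) = \<phi> x" using y by (simp add: Fix_def conj')
      then have "x \<in> Fix \<tau>\<^sub>1" using bij by (simp add: Fix_def bij_def inj_eq)
      then show "y \<in> \<phi> ` Fix \<tau>\<^sub>1" using x by blast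
    qed
  qed
  then have "bij_betw \<phi> (Fix \<tau>\<^sub>1) (Fix \<tau>\<^sub>2)"
    using bij by (auto simp: bij_betw_def bij_def intro: inj_on_subset)
  then show ?thesis
    using \<phi> by (simp add: composition_automorphism_def composition_isomorphism_def algebra_isomorphism_def)
qed

text \<open>The roots \<open>u\<^sub>1\<close> and \<open>u\<^sub>2\<close> are dictated by the
  outer vectors, so \<open>f u\<^sub>1\<close> may differ from \<open>u\<^sub>2\<close>.
  \<open>perp_adjoin_transport\<close> repairs this: it replaces \<open>f a\<^sub>1\<close> by a
  vector of the same norm orthogonal to \<open>adjoin u\<^sub>2\<close>. The resulting frames have
  equal norms and carry the same action.\<close>

lemma (in cayley_space) conjugate_quaternion_type:
  assumes \<tau>1: "order_three_automorphism smul mul n \<tau>\<^sub>1" "dim (Fix \<tau>\<^sub>1) = 4"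
    and \<tau>2: "order_three_automorphism smul mul n \<tau>\<^sub>2" "dim (Fix \<tau>\<^sub>2) = 4"
    and f: "algebra_isomorphism smul (Fix \<tau>\<^sub>1) mul smul (Fix \<tau>\<^sub>2) mul f"
  shows "conjugate_automorphisms smul mul n \<tau>\<^sub>1 \<tau>\<^sub>2"
proof -
  interpret T1: cayley_order_three smul mul n e \<tau>\<^sub>1 by unfold_locales (fact \<tau>1(1))
  interpret T2: cayley_order_three smul mul n e \<tau>\<^sub>2 by unfold_locales (fact \<tau>2(1))
  obtain b\<^sub>1 b\<^sub>2 where b: "b\<^sub>1 \<in> perp (Fix \<tau>\<^sub>1)" "b\<^sub>2 \<in> perp (Fix \<tau>\<^sub>2)" "n b\<^sub>1 = n b\<^sub>2" "n b\<^sub>1 \<noteq> 0"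
    using perp_common_norm[OF T1.regular_Fix _ T2.regular_Fix] \<tau>1(2) \<tau>2(2) by auto
  then have nb2: "n b\<^sub>2 \<noteq> 0" by simp
  obtain u\<^sub>1 a\<^sub>1 where fr1: "frame u\<^sub>1 a\<^sub>1 b\<^sub>1" and ua: "u\<^sub>1 \<in> Fix \<tau>\<^sub>1" "a\<^sub>1 \<in> Fix \<tau>\<^sub>1" "\<tau>\<^sub>1 b\<^sub>1 = u\<^sub>1 \<cdot> b\<^sub>1"
    using T1.quaternion_type_frame[OF \<tau>1(2) b(1,4)] .
  obtain u\<^sub>2 where u2: "cube_root u\<^sub>2" "u\<^sub>2 \<in> Fix \<tau>\<^sub>2" "\<tau>\<^sub>2 b\<^sub>2 = u\<^sub>2 \<cdot> b\<^sub>2"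
    using T2.cube_root_of_perp_Fix[OF b(2) nb2] by metis
  have u1: "cube_root u\<^sub>1" and a1: "a\<^sub>1 \<in> perp (adjoin u\<^sub>1)" "n a\<^sub>1 \<noteq> 0"
    using fr1 by (auto simp: frame_def)
  note iso = algebra_isomorphism_unit_norm[OF T1.regular_Fix T2.regular_Fix f]
  have e1: "e \<in> Fix \<tau>\<^sub>1" using regular_unit[OF T1.regular_Fix] .
  have mem: "f x \<in> Fix \<tau>\<^sub>2" if "x \<in> Fix \<tau>\<^sub>1" for x
    using f that by (auto simp: algebra_isomorphism_def bij_betw_def)
  have v: "cube_root (f u\<^sub>1)"
    using u1 iso(3)[OF ua(1) e1] iso(1) iso(2)[OF ua(1)] by (simp add: cube_root_def)
  have "f a\<^sub>1 \<in> perp (adjoin (f u\<^sub>1))"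
    using a1(1) iso(3)[OF ua(2,1)] iso(3)[OF ua(2) e1] iso(1)
    by (simp add: in_perp_adjoin_iff[OF v] in_perp_adjoin_iff[OF u1])
  then obtain c where c: "c \<in> Fix \<tau>\<^sub>2" "c \<in> perp (adjoin u\<^sub>2)" "n c = n (f a\<^sub>1)"
    using perp_adjoin_transport[OF T2.regular_Fix u2(1,2) v mem[OF ua(1)] mem[OF ua(2)]] by blast
  then have nc: "n a\<^sub>1 = n c" using iso(2)[OF ua(2)] by simp
  have "double (adjoin u\<^sub>2) c \<subseteq> Fix \<tau>\<^sub>2"
    using adjoin_subset[OF u2(1) T2.regular_Fix u2(2)] c(1)
    by (auto simp: double_def intro!: regular_closed(1,7)[OF T2.regular_Fix])
  then have fr2: "frame u\<^sub>2 c b\<^sub>2"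
    using u2(1) c(2) nc a1(2) b(2) nb2 perp_antimono by (auto simp: frame_def)
  obtain \<phi> where \<phi>: "composition_automorphism smul mul n \<phi>" "\<phi> u\<^sub>1 = u\<^sub>2" "\<phi> a\<^sub>1 = c" "\<phi> b\<^sub>1 = b\<^sub>2"
    and twine: "\<phi> (\<tau>\<^sub>1 u\<^sub>1) = \<tau>\<^sub>2 u\<^sub>2 \<Longrightarrow> \<phi> (\<tau>\<^sub>1 a\<^sub>1) = \<tau>\<^sub>2 c \<Longrightarrow> \<phi> (\<tau>\<^sub>1 b\<^sub>1) = \<tau>\<^sub>2 b\<^sub>2 \<Longrightarrow>
      \<tau>\<^sub>2 \<circ> \<phi> = \<phi> \<circ> \<tau>\<^sub>1"
    using frame_automorphism[OF fr1 fr2 nc b(3)] T1.tau_automorphism T2.tau_automorphism by metis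
  have "\<phi> (u\<^sub>1 \<cdot> b\<^sub>1) = u\<^sub>2 \<cdot> b\<^sub>2"
    using \<phi> by (simp add: composition_automorphism_def composition_isomorphism_def algebra_isomorphism_def)
  then have "\<tau>\<^sub>2 \<circ> \<phi> = \<phi> \<circ> \<tau>\<^sub>1"
    using twine ua u2 c \<phi> by (simp add: Fix_def)
  then show ?thesis using \<phi>(1) by (auto simp: conjugate_automorphisms_def)
qed

section \<open>Frames of prescribed norms in the Zorn algebra\<close>

locale zorn_cube_root =
  fixes \<omega> :: "'k::field"
  assumes omega: "\<omega> * \<omega> = - \<omega> - 1" and three: "(3 :: 'k) \<noteq> 0"
begin

sublocale Z: cayley_space "(*s) :: 'k \<Rightarrow> 'k ^ zorn_index \<Rightarrow> 'k ^ zorn_index" zorn_mult zorn_norm zorn_unit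
  by (rule cayley_space_of_cayley_algebra[OF cayley_algebra_zorn three])

definition zorn_w :: "'k ^ zorn_index" where
  "zorn_w = (\<chi> p. case p of E1 \<Rightarrow> \<omega> | E2 \<Rightarrow> \<omega> * \<omega> | _ \<Rightarrow> 0)"

text \<open>Constant along the indices, hence fixed by \<open>tau_st\<close>; the parameter makes
  the norm \<open>3 * \<alpha>\<close> arbitrary.\<close>

definition zorn_a :: "'k \<Rightarrow> 'k ^ zorn_index" where
  "zorn_a \<alpha> = (\<chi> p. case p of U i \<Rightarrow> 1 | V i \<Rightarrow> \<alpha> | _ \<Rightarrow> 0)"

text \<open>An eigenvector of \<open>tau_st\<close> on the \<open>U\<close>- and on the \<open>V\<close>-part, with eigenvalues \<open>\<omega>\<close> and \<open>\<omega>\<^sup>2\<close>.\<close>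

definition zorn_b :: "'k \<Rightarrow> 'k ^ zorn_index" where
  "zorn_b \<beta> = (\<chi> p. case p of
     U i \<Rightarrow> if i = 0 then 1 else if i = 1 then \<omega> * \<omega> else \<omega>
   | V i \<Rightarrow> \<beta> * (if i = 0 then 1 else if i = 1 then \<omega> else \<omega> * \<omega>) | _ \<Rightarrow> 0)"

lemma zorn_frame_nth:
  "zorn_w $ E1 = \<omega>" "zorn_w $ E2 = \<omega> * \<omega>" "zorn_w $ U i = 0" "zorn_w $ V i = 0"
  "zorn_a \<alpha> $ E1 = 0" "zorn_a \<alpha> $ E2 = 0" "zorn_a \<alpha> $ U i = 1" "zorn_a \<alpha> $ V i = \<alpha>"
  "zorn_b \<beta> $ E1 = 0" "zorn_b \<beta> $ E2 = 0"
  "zorn_b \<beta> $ U 0 = 1" "zorn_b \<beta> $ U 1 = - \<omega> - 1" "zorn_b \<beta> $ U 2 = \<omega>"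
  "zorn_b \<beta> $ V 0 = \<beta>" "zorn_b \<beta> $ V 1 = \<beta> * \<omega>" "zorn_b \<beta> $ V 2 = \<beta> * (- \<omega> - 1)"
  by (simp_all add: zorn_w_def zorn_a_def zorn_b_def omega)

lemma omega_mul_omega: "\<omega> * (\<omega> * x) = - (\<omega> * x) - x"
  using arg_cong[OF omega, of "\<lambda>y. y * x"] by (simp add: algebra_simps)

lemma zorn_norms: "zorn_norm (zorn_a \<alpha>) = 3 * \<alpha>" "zorn_norm (zorn_b \<beta>) = 3 * \<beta>"
  by (simp_all add: zorn_norm_def sum_3_zero zorn_frame_nth omega omega_mul_omega algebra_simps)

lemma cube_root_zorn_w: "Z.cube_root zorn_w"
  by (simp add: Z.cube_root_def zorn_norm_def polar_zorn zorn_frame_nth zorn_unit_nth omega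
      omega_mul_omega algebra_simps)

lemma zorn_frame:
  assumes "\<alpha> \<noteq> 0" "\<beta> \<noteq> 0" shows "Z.frame zorn_w (zorn_a \<alpha>) (zorn_b \<beta>)"
proof -
  have "zorn_a \<alpha> \<in> Z.perp (Z.adjoin zorn_w)"
    by (simp add: Z.in_perp_adjoin_iff[OF cube_root_zorn_w] polar_zorn zorn_frame_nth zorn_unit_nth)
  moreover have "zorn_b \<beta> \<in> Z.perp (Z.double (Z.adjoin zorn_w) (zorn_a \<alpha>))"
    by (auto simp: Z.perp_def Z.double_def Z.adjoin_def polar_zorn zorn_frame_nth zorn_unit_nth
        zorn_mult_nth sum_3_zero algebra_simps)
  ultimately show ?thesis
    using cube_root_zorn_w assms three by (simp add: Z.frame_def zorn_norms)
qed

text \<open>These are the relations that \<open>\<tau>\<close> satisfies on a frame from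
  \<open>quaternion_type_frame\<close>, so matching the frames matches the automorphisms.\<close>

lemma tau_st_frame: "tau_st zorn_w = zorn_w" "tau_st (zorn_a \<alpha>) = zorn_a \<alpha>"
  "tau_st (zorn_b \<beta>) = zorn_mult zorn_w (zorn_b \<beta>)"
  by (simp_all add: vec_zorn_eq_iff forall_3_zero tau_st_nth zorn_mult_nth zorn_frame_nth
      numeral_3_arith omega omega_mul_omega algebra_simps)

end

text \<open>With \<open>\<sigma>\<close> the embedding into the algebraic closure, \<open>g\<close>
  exhibits the Petersson algebra as Okubo; with \<open>\<sigma>\<close> the identity, the same
  \<open>g\<close> is the isomorphism onto the split algebras.\<close>

lemma (in cayley_order_three) zorn_embedding:
  fixes \<sigma> :: "'f \<Rightarrow> 'k::field" and \<omega> :: 'k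
  assumes dim: "dim (Fix \<tau>) = 4"
    and sigma: "\<sigma> 1 = 1" "\<And>a b. \<sigma> (a + b) = \<sigma> a + \<sigma> b" "\<And>a b. \<sigma> (a * b) = \<sigma> a * \<sigma> b"
    and omega: "\<omega> * \<omega> = - \<omega> - 1"
  shows "\<exists>g. scalar_extension \<sigma> smul UNIV star (*s) UNIV split_okubo_mult g \<and>
    (surj \<sigma> \<longrightarrow> bij g) \<and> (\<forall>x y. g (x + y) = g x + g y) \<and> (\<forall>c x. g (c \<star> x) = \<sigma> c *s g x) \<and>
    (\<forall>x y. g (x \<cdot> y) = zorn_mult (g x) (g y)) \<and> (\<forall>x. zorn_norm (g x) = \<sigma> (n x)) \<and>
    (\<forall>x. g (\<tau> x) = tau_st (g x)) \<and> (\<forall>x y. g (x \<diamondop> y) = split_okubo_mult (g x) (g y))"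
proof -
  have "(3 :: 'f) = 1 + 1 + 1" "(3 :: 'k) = 1 + 1 + 1" by simp_all
  then have "\<sigma> 3 = 3" by (simp only: sigma)
  moreover have "\<sigma> 3 * \<sigma> (inverse 3) = 1" using three_nonzero sigma(1,3) by (metis right_inverse)
  ultimately have three: "(3 :: 'k) \<noteq> 0" by auto
  interpret Z: zorn_cube_root \<omega> by unfold_locales (fact omega three)+
  interpret P: cayley_pair smul mul n e "(*s) :: 'k \<Rightarrow> 'k ^ zorn_index \<Rightarrow> _" zorn_mult zorn_norm zorn_unit \<sigma>
    by unfold_locales (fact sigma)+
  obtain b where b: "b \<in> perp (Fix \<tau>)" "n b \<noteq> 0" by (rule perp_Fix_anisotropic)
  obtain u a where fr: "frame u a b" and ua: "u \<in> Fix \<tau>" "a \<in> Fix \<tau>" "\<tau> b = u \<cdot> b"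
    by (rule quaternion_type_frame[OF dim b])
  \<comment> \<open>Division by 3 offsets the factor in \<open>zorn_norms\<close>.\<close>
  let ?a = "Z.zorn_a (\<sigma> (n a) / 3)" and ?b = "Z.zorn_b (\<sigma> (n b) / 3)"
  have fr': "Z.Z.frame Z.zorn_w ?a ?b"
    using fr three by (intro Z.zorn_frame) (simp_all add: frame_def P.sigma_eq_0)
  have "zorn_norm ?a = \<sigma> (n a)" "zorn_norm ?b = \<sigma> (n b)"
    using three by (simp_all add: Z.zorn_norms)
  then obtain g where g: "P.semi_embedding UNIV g" "g u = Z.zorn_w" "g a = ?a" "g b = ?b"
    using P.frame_embedding[OF fr fr'] by metis
  have twine: "g (\<tau> x) = tau_st (g x)" for x
    using P.emb_intertwines[OF g(1) fr tau_automorphism composition_automorphism_tau_st]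
      FixD[OF ua(1)] FixD[OF ua(2)] ua(3) P.emb_UNIV[OF g(1)]
    by (simp add: g(2-4) Z.tau_st_frame)
  have okubo: "g (x \<diamondop> y) = split_okubo_mult (g x) (g y)" for x y
    unfolding split_okubo_mult_def by (rule P.emb_petersson[OF g(1)]) (rule twine)
  have "scalar_extension \<sigma> smul UNIV star (*s) UNIV split_okubo_mult g"
  proof (rule P.emb_scalar_extension[OF g(1) fr])
    show "Z.Z.frame (g u) (g a) (g b)" using fr' by (simp only: g(2-4))
  qed (rule okubo)
  moreover have "surj \<sigma> \<longrightarrow> bij g"
    using fr' by (intro impI P.emb_bij[OF g(1), of u a b]) (simp_all only: g(2-4))
  ultimately show ?thesis
    using P.emb_UNIV[OF g(1)] twine okubo by (intro exI[of _ g]) (simp only: simp_thms)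
qed

lemma composition_automorphism_inv_comp:
  assumes f: "composition_isomorphism smul UNIV mul n smul' UNIV mul' n' f"
    and g: "composition_isomorphism smul UNIV mul n smul' UNIV mul' n' g"
  shows "composition_automorphism smul mul n (inv_into UNIV g \<circ> f)"
proof -
  have bij: "bij f" "bij g"
    using f g by (simp_all add: composition_isomorphism_def algebra_isomorphism_def)
  have hom: "h (x + y) = h x + h y" "h (smul c x) = smul' c (h x)" "h (mul x y) = mul' (h x) (h y)"
    "n' (h x) = n x" if "h = f \<or> h = g" for h c x y
    using f g that by (auto simp: composition_isomorphism_def algebra_isomorphism_def)
  have g_inv: "g (inv_into UNIV g y) = y" for y using bij(2) by (simp add: bij_def surj_f_inv_f)
  have inv_eq: "inv_into UNIV g (g x) = x" for x using bij(2) by (simp add: bij_def inv_f_f)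
  have "bij (inv_into UNIV g \<circ> f)" using bij by (simp add: bij_comp bij_imp_bij_inv)
  moreover have "inv_into UNIV g (f (x + y)) = inv_into UNIV g (f x) + inv_into UNIV g (f y)" for x y
    by (metis g_inv inv_eq hom(1))
  moreover have "inv_into UNIV g (f (smul c x)) = smul c (inv_into UNIV g (f x))" for c x
    by (metis g_inv inv_eq hom(2))
  moreover have "inv_into UNIV g (f (mul x y)) = mul (inv_into UNIV g (f x)) (inv_into UNIV g (f y))" for x y
    by (metis g_inv inv_eq hom(3))
  moreover have "n (inv_into UNIV g (f x)) = n x" for x
    by (metis g_inv hom(4))
  ultimately show ?thesis
    by (simp add: composition_automorphism_def composition_isomorphism_def algebra_isomorphism_def)
qed

lemma cube_root_of_unity_eq:
  fixes \<omega> :: "'f::field"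
  assumes "\<omega> ^ 3 = 1" "\<omega> \<noteq> 1" shows "\<omega> * \<omega> = - \<omega> - 1"
proof -
  have "(\<omega> - 1) * (\<omega> * \<omega> + \<omega> + 1) = 0"
    using assms(1) by (simp add: power3_eq_cube algebra_simps)
  then have "\<omega> * \<omega> + \<omega> + 1 = 0" using assms(2) by simp
  then show ?thesis by (simp add: eq_diff_eq eq_neg_iff_add_eq_0 add_ac)
qed

lemma alg_closed_cube_root: obtains \<omega> :: "'k::alg_closed_field" where "\<omega> * \<omega> = - \<omega> - 1"
proof -
  obtain \<omega> :: 'k where "poly [:1, 1, 1:] \<omega> = 0"
    using alg_closed_imp_poly_has_root[of "[:1, 1, 1 :: 'k:]"] by auto
  then have "1 + (\<omega> + \<omega> * \<omega>) = 0" by (simp add: algebra_simps)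
  then have "\<omega> * \<omega> = - \<omega> - 1" by (simp add: eq_diff_eq eq_neg_iff_add_eq_0 add_ac)
  then show ?thesis using that by blast
qed

theorem theorem5p1:
  fixes smul :: "'f::field \<Rightarrow> 'c::ab_group_add \<Rightarrow> 'c"
    and mul :: "'c \<Rightarrow> 'c \<Rightarrow> 'c"
    and n :: "'c \<Rightarrow> 'f"
    and e :: 'c
    and \<tau> :: "'c \<Rightarrow> 'c"
  assumes "cayley_algebra smul UNIV mul n e"
    and "CHAR('f) \<noteq> 3"
    and "order_three_automorphism smul mul n \<tau>"
  shows
    "((\<exists>w. conjugation_by_cube_root smul mul e \<tau> w) \<or>
      fixes_quaternion_with_cube_root smul mul n e \<tau>)
   \<and> (\<forall>w. conjugation_by_cube_root smul mul e \<tau> w \<longrightarrow>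
        para_cayley_algebra smul UNIV (petersson smul mul n e \<tau>) n \<and>
        para_unit smul UNIV (petersson smul mul n e \<tau>) n w \<and>
        Fix \<tau> = {smul a e + smul b w | a b. True} \<and>
        quadratic_etale_algebra smul (Fix \<tau>) mul n e)
   \<and> (\<forall>\<tau>\<^sub>1 \<tau>\<^sub>2.
        order_three_automorphism smul mul n \<tau>\<^sub>1 \<and>
        order_three_automorphism smul mul n \<tau>\<^sub>2 \<and>
        (\<exists>w. conjugation_by_cube_root smul mul e \<tau>\<^sub>1 w) \<and>
        (\<exists>w. conjugation_by_cube_root smul mul e \<tau>\<^sub>2 w) \<longrightarrow>
        conjugate_automorphisms smul mul n \<tau>\<^sub>1 \<tau>\<^sub>2)
   \<and> (fixes_quaternion_with_cube_root smul mul n e \<tau> \<longrightarrow>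
        okubo_algebra smul UNIV (petersson smul mul n e \<tau>))
   \<and> (\<forall>\<tau>\<^sub>1 \<tau>\<^sub>2.
        order_three_automorphism smul mul n \<tau>\<^sub>1 \<and>
        order_three_automorphism smul mul n \<tau>\<^sub>2 \<and>
        fixes_quaternion_with_cube_root smul mul n e \<tau>\<^sub>1 \<and>
        fixes_quaternion_with_cube_root smul mul n e \<tau>\<^sub>2 \<longrightarrow>
        (conjugate_automorphisms smul mul n \<tau>\<^sub>1 \<tau>\<^sub>2 \<longleftrightarrow>
         (\<exists>f. algebra_isomorphism smul (Fix \<tau>\<^sub>1) mul smul (Fix \<tau>\<^sub>2) mul f)))
   \<and> ((\<exists>\<omega>::'f. \<omega> ^ 3 = 1 \<and> \<omega> \<noteq> 1) \<longrightarrow>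
        (fixes_quaternion_with_cube_root smul mul n e \<tau> \<longrightarrow>
           is_split_cayley smul UNIV mul n \<and>
           is_split_okubo smul UNIV (petersson smul mul n e \<tau>) n) \<and>
        (\<forall>\<tau>\<^sub>1 \<tau>\<^sub>2.
           order_three_automorphism smul mul n \<tau>\<^sub>1 \<and>
           order_three_automorphism smul mul n \<tau>\<^sub>2 \<and>
           fixes_quaternion_with_cube_root smul mul n e \<tau>\<^sub>1 \<and>
           fixes_quaternion_with_cube_root smul mul n e \<tau>\<^sub>2 \<longrightarrow>
           conjugate_automorphisms smul mul n \<tau>\<^sub>1 \<tau>\<^sub>2))"
proof -
  have three: "(3 :: 'f) \<noteq> 0" using assms(2) three_nonzero_iff by blast
  interpret C: cayley_space smul mul n e
    by (rule cayley_space_of_cayley_algebra[OF assms(1) three])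
  have T: "cayley_order_three smul mul n e \<tau>'" if "order_three_automorphism smul mul n \<tau>'" for \<tau>'
    by unfold_locales (fact that)
  interpret cayley_order_three smul mul n e \<tau> by (rule T[OF assms(3)])
  have dim4: "C.dim (Fix \<tau>') = 4" if "fixes_quaternion_with_cube_root smul mul n e \<tau>'" for \<tau>'
    using that by (simp add: fixes_quaternion_with_cube_root_def quaternion_algebra_def
        quaternion_algebra_axioms_def)
  have split: "\<exists>g. composition_isomorphism smul UNIV mul n (*s) UNIV zorn_mult zorn_norm g \<and>
      composition_isomorphism smul UNIV (petersson smul mul n e \<tau>') n (*s) UNIV split_okubo_mult zorn_norm g \<and>
      (\<forall>x. g (\<tau>' x) = tau_st (g x))"
    if o: "order_three_automorphism smul mul n \<tau>'" "fixes_quaternion_with_cube_root smul mul n e \<tau>'"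
      and \<omega>: "\<exists>\<omega>::'f. \<omega> ^ 3 = 1 \<and> \<omega> \<noteq> 1" for \<tau>'
  proof -
    interpret T': cayley_order_three smul mul n e \<tau>' by (rule T[OF o(1)])
    obtain \<omega> :: 'f where "\<omega> * \<omega> = - \<omega> - 1" using \<omega> cube_root_of_unity_eq by blast
    from T'.zorn_embedding[OF dim4[OF o(2)] refl refl refl this] obtain g where
      "surj (\<lambda>c::'f. c) \<Longrightarrow> bij g" "\<And>x y. g (x + y) = g x + g y"
      "\<And>c x. g (smul c x) = c *s g x" "\<And>x y. g (mul x y) = zorn_mult (g x) (g y)"
      "\<And>x. zorn_norm (g x) = n x" "\<And>x. g (\<tau>' x) = tau_st (g x)"
      "\<And>x y. g (petersson smul mul n e \<tau>' x y) = split_okubo_mult (g x) (g y)"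
      by blast
    moreover from this have "bij g" by (simp add: surj_def)
    ultimately show ?thesis
      by (intro exI[of _ g]) (simp add: composition_isomorphism_def algebra_isomorphism_def)
  qed
  show ?thesis
  proof (intro conjI allI impI, goal_cases)
    case 1
    show ?case by (rule order_three_dichotomy)
  next
    case (2 w)
    then show ?case using para_cayley_star C.dim_eight by blast
  next
    case (3 w)
    then show ?case by (rule para_unit_cube_root)
  next
    case (4 w)
    then show ?case using Fix_conj by (simp add: C.adjoin_def)
  next
    case (5 w)
    then show ?case by (rule quadratic_etale_Fix)
  next
    case (6 \<tau>\<^sub>1 \<tau>\<^sub>2)
    then show ?case using C.conjugate_conjugation by blast
  next
    case 7
    obtain \<omega> :: "'f alg_closure" where "\<omega> * \<omega> = - \<omega> - 1" by (rule alg_closed_cube_root)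
    from zorn_embedding[OF dim4[OF 7] to_ac_1 to_ac_add to_ac_mult this]
    show ?case unfolding okubo_algebra_def by blast
  next
    case (8 \<tau>\<^sub>1 \<tau>\<^sub>2)
    show ?case
    proof
      assume "conjugate_automorphisms smul mul n \<tau>\<^sub>1 \<tau>\<^sub>2"
      then show "\<exists>f. algebra_isomorphism smul (Fix \<tau>\<^sub>1) mul smul (Fix \<tau>\<^sub>2) mul f"
        using algebra_isomorphism_Fix unfolding conjugate_automorphisms_def by blast
    next
      assume "\<exists>f. algebra_isomorphism smul (Fix \<tau>\<^sub>1) mul smul (Fix \<tau>\<^sub>2) mul f"
      then show "conjugate_automorphisms smul mul n \<tau>\<^sub>1 \<tau>\<^sub>2"
        using C.conjugate_quaternion_type 8 dim4 by blast
    qed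
  next
    case 9
    then show ?case using split[OF assms(3)] unfolding is_split_cayley_def by blast
  next
    case 10
    then show ?case using split[OF assms(3)] unfolding is_split_okubo_def by blast
  next
    case (11 \<tau>\<^sub>1 \<tau>\<^sub>2)
    \<comment> \<open>Both automorphisms become \<open>tau_st\<close> under isomorphisms
      \<open>f\<close> and \<open>g\<close> onto the Zorn algebra, so the inverse of
      \<open>g\<close> after \<open>f\<close> conjugates one to the other.\<close>
    obtain f where f: "composition_isomorphism smul UNIV mul n (*s) UNIV zorn_mult zorn_norm f"
        "\<And>x. f (\<tau>\<^sub>1 x) = tau_st (f x)"
      using split[of \<tau>\<^sub>1] 11 by blast
    obtain g where g: "composition_isomorphism smul UNIV mul n (*s) UNIV zorn_mult zorn_norm g"
        "\<And>x. g (\<tau>\<^sub>2 x) = tau_st (g x)"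
      using split[of \<tau>\<^sub>2] 11 by blast
    have "bij g" using g(1) by (simp add: composition_isomorphism_def algebra_isomorphism_def)
    then have inv: "g (inv_into UNIV g y) = y" "inv_into UNIV g (g x) = x" for x y
      by (simp_all add: bij_def surj_f_inv_f inv_f_f)
    have "\<tau>\<^sub>2 (inv_into UNIV g (f x)) = inv_into UNIV g (f (\<tau>\<^sub>1 x))" for x
      by (metis f(2) g(2) inv)
    then have "\<tau>\<^sub>2 \<circ> (inv_into UNIV g \<circ> f) = (inv_into UNIV g \<circ> f) \<circ> \<tau>\<^sub>1" by (simp add: fun_eq_iff)
    then show ?case
      using composition_automorphism_inv_comp[OF f(1) g(1)]
      unfolding conjugate_automorphisms_def by blast
  qed
qed

end
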